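(* Let $A:\mathcal{U}$, $B:A\to\mathcal{U}$, and $W_{AB}$, $\mathsf{sup}$, $\mathsf{rec}_W$, $\mathsf{MorphW}$ as in the context. For all $X:\mathcal{U}$, $g:\prod_{a:A}(B(a)\to X)\to X$ and $f:W_{AB}\to X$, $$\mathsf{MorphW}\ W_{AB}\,\mathsf{sup}\ \ X\,g\ \ f\ \to\ f = \mathsf{rec}_W\,X\,g .$$
   Context: Type theory: intensional Martin-Löf type theory with universes $\mathcal{U}:\mathcal{U}_0:\cdots$, bottom universe $\mathcal{U}$ impredicative (if $A$ is a type in any universe and $a:A\vdash B:\mathcal{U}$ then $\prod_{a:A}B:\mathcal{U}$), universes closed under $\Sigma$ and identity types; $\pi_1,\pi_2$ projections, $f\circ g := \lambda x.f(g\,x)$. Axioms: function extensionality and UIP. Fix $A:\mathcal{U}$, $B:A\to\mathcal{U}$. $W^*_{AB} := \prod_{X:\mathcal{U}}\big(\prod_{a:A}(B(a)\to X)\to X\big)\to X$; $\mathsf{sup}^*\,a\,r := \lambda X\,g.\ g\,a\,(\lambda b.\ r\,b\,X\,g)$; $\mathsf{rec}^*_W\,X\,g\,w := w\,X\,g$. For $g:\prod_{a:A}(B(a)\to X)\to X$, $g':\prod_{a:A}(B(a)\to Y)\to Y$, $f:X\to Y$: $\mathsf{MorphW}\,X\,g\ Y\,g'\ f := \prod_{a:A}\prod_{t:B(a)\to X} f(g\,a\,t) = g'\,a\,(f\circ t)$. $\mathsf{LimW}\,w := \prod_{X,Y:\mathcal{U}}\prod_{g,g'}\prod_{f:X\to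 Y}\mathsf{MorphW}\,X\,g\ Y\,g'\ f\to f(\mathsf{rec}^*_W\,X\,g\,w) = \mathsf{rec}^*_W\,Y\,g'\,w$. $W_{AB} := \sum_{w:W^*_{AB}}\mathsf{LimW}\,w$. With a proof $p:\prod_{a}\prod_{r:B(a)\to W_{AB}}\mathsf{LimW}(\mathsf{sup}^*\,a\,(\pi_1\circ r))$ (which exists): $\mathsf{sup}\,a\,r := \langle\mathsf{sup}^*\,a\,(\pi_1\circ r), p\,a\,r\rangle$, $\mathsf{rec}_W\,X\,g\,w := \mathsf{rec}^*_W\,X\,g\,(\pi_1 w)$. *)

theory Defs
  imports Main
begin

text \<open>
  Raw terms of intensional Martin-Loef type theory with de Bruijn indices. Types are terms
  (universes a la Russell). \<open>Univ 0\<close> is the impredicative bottom universe; the predicative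
  universes above it are \<open>Univ 1, Univ 2, \<dots>\<close>.

  Binding: \<open>Pi A B\<close>, \<open>Lam A b\<close> and \<open>Sig A B\<close> bind one variable in their second argument.
  \<open>Split C d p\<close> (the dependent eliminator of \<open>Sig\<close>) binds one variable in the motive \<open>C\<close> and two
  in \<open>d\<close> (index 1 is the first component, index 0 the second).
  \<open>J C c a b p\<close> (the eliminator of \<open>Eq\<close>) binds three variables in the motive \<open>C\<close> (index 2 is
  the left end point, index 1 the right end point, index 0 the identity proof) and one in \<open>c\<close>.
\<close>

datatype tm =
    Var nat
  | Univ nat
  | Pi tm tm
  | Lam tm tm
  | App tm tm
  | Sig tm tm
  | MkPair tm tm
  | Split tm tm tm
  | Eq tm tm tm
  | Refl tm
  | J tm tm tm tm tm
  | FunExt nat nat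
  | UIP nat

definition up_ren :: "(nat \<Rightarrow> nat) \<Rightarrow> nat \<Rightarrow> nat" where
  "up_ren \<rho> = case_nat 0 (\<lambda>i. Suc (\<rho> i))"

primrec ren :: "(nat \<Rightarrow> nat) \<Rightarrow> tm \<Rightarrow> tm" where
  "ren \<rho> (Var i) = Var (\<rho> i)"
| "ren \<rho> (Univ i) = Univ i"
| "ren \<rho> (Pi A B) = Pi (ren \<rho> A) (ren (up_ren \<rho>) B)"
| "ren \<rho> (Lam A b) = Lam (ren \<rho> A) (ren (up_ren \<rho>) b)"
| "ren \<rho> (App f a) = App (ren \<rho> f) (ren \<rho> a)"
| "ren \<rho> (Sig A B) = Sig (ren \<rho> A) (ren (up_ren \<rho>) B)"
| "ren \<rho> (MkPair a b) = MkPair (ren \<rho> a) (ren \<rho> b)"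
| "ren \<rho> (Split C d p) =
     Split (ren (up_ren \<rho>) C) (ren (up_ren (up_ren \<rho>)) d) (ren \<rho> p)"
| "ren \<rho> (Eq A a b) = Eq (ren \<rho> A) (ren \<rho> a) (ren \<rho> b)"
| "ren \<rho> (Refl a) = Refl (ren \<rho> a)"
| "ren \<rho> (J C c a b p) =
     J (ren (up_ren (up_ren (up_ren \<rho>))) C) (ren (up_ren \<rho>) c) (ren \<rho> a) (ren \<rho> b) (ren \<rho> p)"
| "ren \<rho> (FunExt i j) = FunExt i j"
| "ren \<rho> (UIP i) = UIP i"

definition lift :: "nat \<Rightarrow> tm \<Rightarrow> tm" where
  "lift k = ren (\<lambda>i. i + k)"

definition up_subst :: "(nat \<Rightarrow> tm) \<Rightarrow> nat \<Rightarrow> tm" where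
  "up_subst \<sigma> = case_nat (Var 0) (\<lambda>i. lift 1 (\<sigma> i))"

primrec subst :: "(nat \<Rightarrow> tm) \<Rightarrow> tm \<Rightarrow> tm" where
  "subst \<sigma> (Var i) = \<sigma> i"
| "subst \<sigma> (Univ i) = Univ i"
| "subst \<sigma> (Pi A B) = Pi (subst \<sigma> A) (subst (up_subst \<sigma>) B)"
| "subst \<sigma> (Lam A b) = Lam (subst \<sigma> A) (subst (up_subst \<sigma>) b)"
| "subst \<sigma> (App f a) = App (subst \<sigma> f) (subst \<sigma> a)"
| "subst \<sigma> (Sig A B) = Sig (subst \<sigma> A) (subst (up_subst \<sigma>) B)"
| "subst \<sigma> (MkPair a b) = MkPair (subst \<sigma> a) (subst \<sigma> b)"
| "subst \<sigma> (Split C d p) =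
     Split (subst (up_subst \<sigma>) C) (subst (up_subst (up_subst \<sigma>)) d) (subst \<sigma> p)"
| "subst \<sigma> (Eq A a b) = Eq (subst \<sigma> A) (subst \<sigma> a) (subst \<sigma> b)"
| "subst \<sigma> (Refl a) = Refl (subst \<sigma> a)"
| "subst \<sigma> (J C c a b p) =
     J (subst (up_subst (up_subst (up_subst \<sigma>))) C) (subst (up_subst \<sigma>) c)
       (subst \<sigma> a) (subst \<sigma> b) (subst \<sigma> p)"
| "subst \<sigma> (FunExt i j) = FunExt i j"
| "subst \<sigma> (UIP i) = UIP i"

definition scons :: "tm \<Rightarrow> (nat \<Rightarrow> tm) \<Rightarrow> nat \<Rightarrow> tm" where
  "scons u \<sigma> = case_nat u \<sigma>"

text \<open>In \<open>inst2\<close> and \<open>inst3\<close> the last argument replaces index 0.\<close>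

definition inst1 :: "tm \<Rightarrow> tm \<Rightarrow> tm" where
  "inst1 t a = subst (scons a Var) t"

definition inst2 :: "tm \<Rightarrow> tm \<Rightarrow> tm \<Rightarrow> tm" where
  "inst2 t a b = subst (scons b (scons a Var)) t"

definition inst3 :: "tm \<Rightarrow> tm \<Rightarrow> tm \<Rightarrow> tm \<Rightarrow> tm" where
  "inst3 t a b c = subst (scons c (scons b (scons a Var))) t"

text \<open>
  An \<open>otm\<close> is a term that may be placed at any binding depth \<open>n\<close>. The bound variable
  created at depth \<open>m\<close> is the de Bruijn level \<open>m\<close>, hence the index \<open>n - Suc m\<close> at depth \<open>n\<close>.
  A closed term is obtained by applying an \<open>otm\<close> to \<open>0\<close>. For example
  \<open>PI (UU 0) (\<lambda>A. PI A (\<lambda>x. EQ A x x)) 0\<close> is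
  \<open>Pi (Univ 0) (Pi (Var 0) (Eq (Var 1) (Var 0) (Var 0)))\<close>.
\<close>

type_synonym otm = "nat \<Rightarrow> tm"

definition lvl :: "nat \<Rightarrow> otm" where
  "lvl m = (\<lambda>n. Var (n - Suc m))"

definition UU :: "nat \<Rightarrow> otm" where
  "UU i = (\<lambda>n. Univ i)"

definition PI :: "otm \<Rightarrow> (otm \<Rightarrow> otm) \<Rightarrow> otm" where
  "PI A B = (\<lambda>n. Pi (A n) (B (lvl n) (Suc n)))"

definition ARR :: "otm \<Rightarrow> otm \<Rightarrow> otm" (infixr "\<rightarrow>" 60) where
  "A \<rightarrow> B = PI A (\<lambda>_. B)"

definition LAM :: "otm \<Rightarrow> (otm \<Rightarrow> otm) \<Rightarrow> otm" where
  "LAM A b = (\<lambda>n. Lam (A n) (b (lvl n) (Suc n)))"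

definition APP :: "otm \<Rightarrow> otm \<Rightarrow> otm" (infixl "\<cdot>" 90) where
  "f \<cdot> a = (\<lambda>n. App (f n) (a n))"

definition SIG :: "otm \<Rightarrow> (otm \<Rightarrow> otm) \<Rightarrow> otm" where
  "SIG A B = (\<lambda>n. Sig (A n) (B (lvl n) (Suc n)))"

definition PAIR :: "otm \<Rightarrow> otm \<Rightarrow> otm" where
  "PAIR a b = (\<lambda>n. MkPair (a n) (b n))"

definition SPLIT :: "(otm \<Rightarrow> otm) \<Rightarrow> (otm \<Rightarrow> otm \<Rightarrow> otm) \<Rightarrow> otm \<Rightarrow> otm" where
  "SPLIT C d p =
     (\<lambda>n. Split (C (lvl n) (Suc n)) (d (lvl n) (lvl (Suc n)) (Suc (Suc n))) (p n))"

definition EQ :: "otm \<Rightarrow> otm \<Rightarrow> otm \<Rightarrow> otm" where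
  "EQ A a b = (\<lambda>n. Eq (A n) (a n) (b n))"

definition PROJ1 :: "otm \<Rightarrow> otm \<Rightarrow> otm" where
  "PROJ1 A p = SPLIT (\<lambda>_. A) (\<lambda>x y. x) p"

definition PROJ2 :: "otm \<Rightarrow> (otm \<Rightarrow> otm) \<Rightarrow> otm \<Rightarrow> otm" where
  "PROJ2 A B p = SPLIT (\<lambda>z. B (PROJ1 A z)) (\<lambda>x y. y) p"

text \<open>Composition of maps, the argument ranging over \<open>D\<close>; the maps are given by what they do to a
  term, e.g. \<open>APP f\<close> for a function term \<open>f\<close>, or \<open>PROJ1 A\<close>.\<close>

definition COMP :: "otm \<Rightarrow> (otm \<Rightarrow> otm) \<Rightarrow> (otm \<Rightarrow> otm) \<Rightarrow> otm" where
  "COMP D f g = LAM D (\<lambda>x. f (g x))"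

definition funext_type :: "nat \<Rightarrow> nat \<Rightarrow> tm" where
  "funext_type i j =
     PI (UU i) (\<lambda>A. PI (A \<rightarrow> UU j) (\<lambda>B.
       PI (PI A (\<lambda>x. B \<cdot> x)) (\<lambda>f. PI (PI A (\<lambda>x. B \<cdot> x)) (\<lambda>g.
         PI A (\<lambda>x. EQ (B \<cdot> x) (f \<cdot> x) (g \<cdot> x)) \<rightarrow> EQ (PI A (\<lambda>x. B \<cdot> x)) f g)))) 0"

definition uip_type :: "nat \<Rightarrow> tm" where
  "uip_type i =
     PI (UU i) (\<lambda>A. PI A (\<lambda>a. PI A (\<lambda>b.
       PI (EQ A a b) (\<lambda>p. PI (EQ A a b) (\<lambda>q. EQ (EQ A a b) p q))))) 0"

text \<open>Level of a dependent product with domain in \<open>Univ i\<close> and codomain in \<open>Univ j\<close>: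
  \<open>Univ 0\<close> is closed under products over arbitrary types, the other universes are predicative.\<close>

definition pi_level :: "nat \<Rightarrow> nat \<Rightarrow> nat" where
  "pi_level i j = (if j = 0 then 0 else max i j)"

text \<open>Contexts are lists of types with the most recently declared variable first, so that
  \<open>A # \<Gamma>\<close> extends \<open>\<Gamma>\<close> by \<open>Var 0\<close> of type \<open>A\<close>. The rules are the usual ones of Martin-Loef type theory with typed
  judgemental equality (beta and eta for \<open>Pi\<close>, beta for \<open>Sig\<close> and \<open>Eq\<close>, no equality reflection),
  and with \<open>FunExt\<close> and \<open>UIP\<close> as axioms, i.e. constants without computation rules. Universes are
  not cumulative.\<close>

inductive
  ctx :: "tm list \<Rightarrow> bool" and
  has_type :: "tm list \<Rightarrow> tm \<Rightarrow> tm \<Rightarrow> bool" ("(_ \<turnstile>/ _ \<Colon>/ _)" [51, 51, 51] 50) and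
  jeq :: "tm list \<Rightarrow> tm \<Rightarrow> tm \<Rightarrow> tm \<Rightarrow> bool" ("(_ \<turnstile>/ _ \<doteq> _ \<Colon>/ _)" [51, 51, 51, 51] 50)
where
  ctx_Nil: "ctx []"
| ctx_Cons: "\<Gamma> \<turnstile> A \<Colon> Univ i \<Longrightarrow> ctx (A # \<Gamma>)"

| ty_Var: "ctx \<Gamma> \<Longrightarrow> i < length \<Gamma> \<Longrightarrow> \<Gamma> \<turnstile> Var i \<Colon> lift (Suc i) (\<Gamma> ! i)"
| ty_Conv: "\<Gamma> \<turnstile> a \<Colon> A \<Longrightarrow> \<Gamma> \<turnstile> A \<doteq> B \<Colon> Univ i \<Longrightarrow> \<Gamma> \<turnstile> a \<Colon> B"
| ty_Univ: "ctx \<Gamma> \<Longrightarrow> \<Gamma> \<turnstile> Univ i \<Colon> Univ (Suc i)"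

| ty_Pi: "\<Gamma> \<turnstile> A \<Colon> Univ i \<Longrightarrow> A # \<Gamma> \<turnstile> B \<Colon> Univ j \<Longrightarrow> \<Gamma> \<turnstile> Pi A B \<Colon> Univ (pi_level i j)"
| ty_Lam: "\<Gamma> \<turnstile> A \<Colon> Univ i \<Longrightarrow> A # \<Gamma> \<turnstile> b \<Colon> B \<Longrightarrow> \<Gamma> \<turnstile> Lam A b \<Colon> Pi A B"
| ty_App: "\<Gamma> \<turnstile> f \<Colon> Pi A B \<Longrightarrow> \<Gamma> \<turnstile> a \<Colon> A \<Longrightarrow> \<Gamma> \<turnstile> App f a \<Colon> inst1 B a"

| ty_Sig: "\<Gamma> \<turnstile> A \<Colon> Univ i \<Longrightarrow> A # \<Gamma> \<turnstile> B \<Colon> Univ j \<Longrightarrow> \<Gamma> \<turnstile> Sig A B \<Colon> Univ (max i j)"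
| ty_MkPair: "A # \<Gamma> \<turnstile> B \<Colon> Univ j \<Longrightarrow> \<Gamma> \<turnstile> a \<Colon> A \<Longrightarrow> \<Gamma> \<turnstile> b \<Colon> inst1 B a \<Longrightarrow>
    \<Gamma> \<turnstile> MkPair a b \<Colon> Sig A B"
| ty_Split: "Sig A B # \<Gamma> \<turnstile> C \<Colon> Univ k \<Longrightarrow>
    B # A # \<Gamma> \<turnstile> d \<Colon> subst (scons (MkPair (Var 1) (Var 0)) (\<lambda>i. Var (i + 2))) C \<Longrightarrow>
    \<Gamma> \<turnstile> p \<Colon> Sig A B \<Longrightarrow> \<Gamma> \<turnstile> Split C d p \<Colon> inst1 C p"

| ty_Eq: "\<Gamma> \<turnstile> A \<Colon> Univ i \<Longrightarrow> \<Gamma> \<turnstile> a \<Colon> A \<Longrightarrow> \<Gamma> \<turnstile> b \<Colon> A \<Longrightarrow> \<Gamma> \<turnstile> Eq A a b \<Colon> Univ i"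
| ty_Refl: "\<Gamma> \<turnstile> a \<Colon> A \<Longrightarrow> \<Gamma> \<turnstile> Refl a \<Colon> Eq A a a"
| ty_J: "Eq (lift 2 A) (Var 1) (Var 0) # lift 1 A # A # \<Gamma> \<turnstile> C \<Colon> Univ k \<Longrightarrow>
    A # \<Gamma> \<turnstile> c \<Colon>
      subst (scons (Refl (Var 0)) (scons (Var 0) (scons (Var 0) (\<lambda>i. Var (i + 1))))) C \<Longrightarrow>
    \<Gamma> \<turnstile> a \<Colon> A \<Longrightarrow> \<Gamma> \<turnstile> b \<Colon> A \<Longrightarrow> \<Gamma> \<turnstile> p \<Colon> Eq A a b \<Longrightarrow>
    \<Gamma> \<turnstile> J C c a b p \<Colon> inst3 C a b p"

| ty_FunExt: "ctx \<Gamma> \<Longrightarrow> \<Gamma> \<turnstile> FunExt i j \<Colon> funext_type i j"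
| ty_UIP: "ctx \<Gamma> \<Longrightarrow> \<Gamma> \<turnstile> UIP i \<Colon> uip_type i"

| eq_refl: "\<Gamma> \<turnstile> a \<Colon> A \<Longrightarrow> \<Gamma> \<turnstile> a \<doteq> a \<Colon> A"
| eq_sym: "\<Gamma> \<turnstile> a \<doteq> b \<Colon> A \<Longrightarrow> \<Gamma> \<turnstile> b \<doteq> a \<Colon> A"
| eq_trans: "\<Gamma> \<turnstile> a \<doteq> b \<Colon> A \<Longrightarrow> \<Gamma> \<turnstile> b \<doteq> c \<Colon> A \<Longrightarrow> \<Gamma> \<turnstile> a \<doteq> c \<Colon> A"
| eq_Conv: "\<Gamma> \<turnstile> a \<doteq> b \<Colon> A \<Longrightarrow> \<Gamma> \<turnstile> A \<doteq> B \<Colon> Univ i \<Longrightarrow> \<Gamma> \<turnstile> a \<doteq> b \<Colon> B"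

| beta_Pi: "A # \<Gamma> \<turnstile> b \<Colon> B \<Longrightarrow> \<Gamma> \<turnstile> a \<Colon> A \<Longrightarrow> \<Gamma> \<turnstile> App (Lam A b) a \<doteq> inst1 b a \<Colon> inst1 B a"
| eta_Pi: "\<Gamma> \<turnstile> f \<Colon> Pi A B \<Longrightarrow> \<Gamma> \<turnstile> f \<doteq> Lam A (App (lift 1 f) (Var 0)) \<Colon> Pi A B"
| beta_Sig: "Sig A B # \<Gamma> \<turnstile> C \<Colon> Univ k \<Longrightarrow>
    B # A # \<Gamma> \<turnstile> d \<Colon> subst (scons (MkPair (Var 1) (Var 0)) (\<lambda>i. Var (i + 2))) C \<Longrightarrow>
    \<Gamma> \<turnstile> a \<Colon> A \<Longrightarrow> \<Gamma> \<turnstile> b \<Colon> inst1 B a \<Longrightarrow>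
    \<Gamma> \<turnstile> Split C d (MkPair a b) \<doteq> inst2 d a b \<Colon> inst1 C (MkPair a b)"
| beta_Eq: "Eq (lift 2 A) (Var 1) (Var 0) # lift 1 A # A # \<Gamma> \<turnstile> C \<Colon> Univ k \<Longrightarrow>
    A # \<Gamma> \<turnstile> c \<Colon>
      subst (scons (Refl (Var 0)) (scons (Var 0) (scons (Var 0) (\<lambda>i. Var (i + 1))))) C \<Longrightarrow>
    \<Gamma> \<turnstile> a \<Colon> A \<Longrightarrow>
    \<Gamma> \<turnstile> J C c a a (Refl a) \<doteq> inst1 c a \<Colon> inst3 C a a (Refl a)"

| cong_Pi: "\<Gamma> \<turnstile> A \<Colon> Univ i \<Longrightarrow> \<Gamma> \<turnstile> A \<doteq> A' \<Colon> Univ i \<Longrightarrow> A # \<Gamma> \<turnstile> B \<doteq> B' \<Colon> Univ j \<Longrightarrow>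
    \<Gamma> \<turnstile> Pi A B \<doteq> Pi A' B' \<Colon> Univ (pi_level i j)"
| cong_Lam: "\<Gamma> \<turnstile> A \<Colon> Univ i \<Longrightarrow> \<Gamma> \<turnstile> A \<doteq> A' \<Colon> Univ i \<Longrightarrow> A # \<Gamma> \<turnstile> b \<doteq> b' \<Colon> B \<Longrightarrow>
    \<Gamma> \<turnstile> Lam A b \<doteq> Lam A' b' \<Colon> Pi A B"
| cong_App: "\<Gamma> \<turnstile> f \<doteq> f' \<Colon> Pi A B \<Longrightarrow> \<Gamma> \<turnstile> a \<doteq> a' \<Colon> A \<Longrightarrow>
    \<Gamma> \<turnstile> App f a \<doteq> App f' a' \<Colon> inst1 B a"
| cong_Sig: "\<Gamma> \<turnstile> A \<Colon> Univ i \<Longrightarrow> \<Gamma> \<turnstile> A \<doteq> A' \<Colon> Univ i \<Longrightarrow> A # \<Gamma> \<turnstile> B \<doteq> B' \<Colon> Univ j \<Longrightarrow>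
    \<Gamma> \<turnstile> Sig A B \<doteq> Sig A' B' \<Colon> Univ (max i j)"
| cong_MkPair: "A # \<Gamma> \<turnstile> B \<Colon> Univ j \<Longrightarrow> \<Gamma> \<turnstile> a \<doteq> a' \<Colon> A \<Longrightarrow> \<Gamma> \<turnstile> b \<doteq> b' \<Colon> inst1 B a \<Longrightarrow>
    \<Gamma> \<turnstile> MkPair a b \<doteq> MkPair a' b' \<Colon> Sig A B"
| cong_Split: "Sig A B # \<Gamma> \<turnstile> C \<doteq> C' \<Colon> Univ k \<Longrightarrow>
    B # A # \<Gamma> \<turnstile> d \<doteq> d' \<Colon> subst (scons (MkPair (Var 1) (Var 0)) (\<lambda>i. Var (i + 2))) C \<Longrightarrow>
    \<Gamma> \<turnstile> p \<doteq> p' \<Colon> Sig A B \<Longrightarrow>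
    \<Gamma> \<turnstile> Split C d p \<doteq> Split C' d' p' \<Colon> inst1 C p"
| cong_Eq: "\<Gamma> \<turnstile> A \<doteq> A' \<Colon> Univ i \<Longrightarrow> \<Gamma> \<turnstile> a \<doteq> a' \<Colon> A \<Longrightarrow> \<Gamma> \<turnstile> b \<doteq> b' \<Colon> A \<Longrightarrow>
    \<Gamma> \<turnstile> Eq A a b \<doteq> Eq A' a' b' \<Colon> Univ i"
| cong_Refl: "\<Gamma> \<turnstile> a \<doteq> a' \<Colon> A \<Longrightarrow> \<Gamma> \<turnstile> Refl a \<doteq> Refl a' \<Colon> Eq A a a"
| cong_J: "Eq (lift 2 A) (Var 1) (Var 0) # lift 1 A # A # \<Gamma> \<turnstile> C \<doteq> C' \<Colon> Univ k \<Longrightarrow>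
    A # \<Gamma> \<turnstile> c \<doteq> c' \<Colon>
      subst (scons (Refl (Var 0)) (scons (Var 0) (scons (Var 0) (\<lambda>i. Var (i + 1))))) C \<Longrightarrow>
    \<Gamma> \<turnstile> a \<doteq> a' \<Colon> A \<Longrightarrow> \<Gamma> \<turnstile> b \<doteq> b' \<Colon> A \<Longrightarrow> \<Gamma> \<turnstile> p \<doteq> p' \<Colon> Eq A a b \<Longrightarrow>
    \<Gamma> \<turnstile> J C c a b p \<doteq> J C' c' a' b' p' \<Colon> inst3 C a b p"

definition inhabited :: "tm \<Rightarrow> bool" where
  "inhabited T \<longleftrightarrow> (\<exists>t. [] \<turnstile> t \<Colon> T)"

definition AlgW :: "otm \<Rightarrow> otm \<Rightarrow> otm \<Rightarrow> otm" where
  "AlgW A B X = PI A (\<lambda>a. (B \<cdot> a \<rightarrow> X) \<rightarrow> X)"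

definition Wstar :: "otm \<Rightarrow> otm \<Rightarrow> otm" where
  "Wstar A B = PI (UU 0) (\<lambda>X. AlgW A B X \<rightarrow> X)"

definition supstar :: "otm \<Rightarrow> otm \<Rightarrow> otm \<Rightarrow> otm \<Rightarrow> otm" where
  "supstar A B a r =
     LAM (UU 0) (\<lambda>X. LAM (AlgW A B X) (\<lambda>g. g \<cdot> a \<cdot> LAM (B \<cdot> a) (\<lambda>b. r \<cdot> b \<cdot> X \<cdot> g)))"

definition recstar :: "otm \<Rightarrow> otm \<Rightarrow> otm \<Rightarrow> otm" where
  "recstar X g w = w \<cdot> X \<cdot> g"

definition MorphW :: "otm \<Rightarrow> otm \<Rightarrow> otm \<Rightarrow> otm \<Rightarrow> otm \<Rightarrow> otm \<Rightarrow> otm \<Rightarrow> otm" where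
  "MorphW A B X g Y g' f =
     PI A (\<lambda>a. PI (B \<cdot> a \<rightarrow> X) (\<lambda>t.
       EQ Y (f \<cdot> (g \<cdot> a \<cdot> t)) (g' \<cdot> a \<cdot> COMP (B \<cdot> a) (APP f) (APP t))))"

definition LimW :: "otm \<Rightarrow> otm \<Rightarrow> otm \<Rightarrow> otm" where
  "LimW A B w =
     PI (UU 0) (\<lambda>X. PI (UU 0) (\<lambda>Y. PI (AlgW A B X) (\<lambda>g. PI (AlgW A B Y) (\<lambda>g'.
       PI (X \<rightarrow> Y) (\<lambda>f.
         MorphW A B X g Y g' f \<rightarrow> EQ Y (f \<cdot> recstar X g w) (recstar Y g' w))))))"

definition W :: "otm \<Rightarrow> otm \<Rightarrow> otm" where
  "W A B = SIG (Wstar A B) (\<lambda>w. LimW A B w)"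

text \<open>The type of proofs that \<open>supstar\<close>, applied to elements of \<open>W A B\<close>, satisfies \<open>LimW\<close>;
  \<open>sup\<close> and everything built from it is parametrised by such a proof \<open>p\<close>.\<close>

definition SupLim :: "otm \<Rightarrow> otm \<Rightarrow> otm" where
  "SupLim A B =
     PI A (\<lambda>a. PI (B \<cdot> a \<rightarrow> W A B) (\<lambda>r.
       LimW A B (supstar A B a (COMP (B \<cdot> a) (PROJ1 (Wstar A B)) (APP r)))))"

definition supW :: "otm \<Rightarrow> otm \<Rightarrow> otm \<Rightarrow> otm" where
  "supW A B p =
     LAM A (\<lambda>a. LAM (B \<cdot> a \<rightarrow> W A B) (\<lambda>r.
       PAIR (supstar A B a (COMP (B \<cdot> a) (PROJ1 (Wstar A B)) (APP r))) (p \<cdot> a \<cdot> r)))"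

definition recW :: "otm \<Rightarrow> otm \<Rightarrow> otm \<Rightarrow> otm \<Rightarrow> otm" where
  "recW A B X g = LAM (W A B) (\<lambda>w. recstar X g (PROJ1 (Wstar A B) w))"

end

(* By UIP and function extensionality LimW w is a proposition, so elements of W are equal as soon as
   their underlying elements of Wstar are. For w in W put v = pi1 w W sup. The property LimW of w, at
   the morphism rec X g : W -> X, says pi1 v X g = pi1 w X g for all X and g; hence v = w. At an
   arbitrary morphism f it says f v = pi1 w X g, so f w = rec X g w.

   Pi-injectivity and normalisation of the type theory are never needed: every conversion is derived
   from a beta rule whose typing premises are at hand. *)

theory Submission
  imports Defs
begin

section \<open>Substitution calculus\<close>

text \<open>The claim is derivability in the object theory, so each step has to produce a typing
  derivation in an explicit context; reasoning under a binder rests on weakening and substitution,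
  which are metatheorems about the rules. \<open>LimW\<close> of w compares values of recursors
  only: for a morphism f out of W it evaluates f at the fold of w by the constructors of W, never at
  w itself. The passage from v to w fills exactly this gap. That fold exists because impredicativity
  keeps W in the bottom universe, so W is an admissible carrier for its own elements. No induction
  principle on W is involved: the recursor commutes with \<open>sup\<close> judgementally, so it is
  a morphism by reflexivity, and \<open>LimW\<close> can be used at it. The proof \<open>p\<close>
  inside \<open>sup\<close> is a variable of the statement, and the argument works for every such
  \<open>p\<close>.\<close>

definition sh :: "nat \<Rightarrow> nat \<Rightarrow> tm" where
  "sh k = (\<lambda>i. Var (i + k))"

abbreviation shift :: "tm \<Rightarrow> nat \<Rightarrow> tm" ("_\<up>_" [1000, 1000] 1000) where
  "t\<up>k \<equiv> subst (sh k) t"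

definition subst_comp :: "(nat \<Rightarrow> tm) \<Rightarrow> (nat \<Rightarrow> tm) \<Rightarrow> nat \<Rightarrow> tm" where
  "subst_comp \<sigma> \<tau> = (\<lambda>i. subst \<sigma> (\<tau> i))"

lemma up_subst_Var: "up_subst (\<lambda>i. Var (\<rho> i)) = (\<lambda>i. Var (up_ren \<rho> i))"
  by (auto simp: up_subst_def up_ren_def lift_def fun_eq_iff split: nat.split)

lemma ren_eq_subst: "ren \<rho> t = subst (\<lambda>i. Var (\<rho> i)) t"
  by (induction t arbitrary: \<rho>) (simp_all add: up_subst_Var)

lemma subst_Var_id [simp]: "subst Var t = t"
proof -
  have up: "up_subst Var = Var"
    by (auto simp: up_subst_def lift_def fun_eq_iff split: nat.split)
  show ?thesis by (induction t) (simp_all add: up)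
qed

lemma subst_ren: "subst \<sigma> (ren \<rho> t) = subst (\<lambda>i. \<sigma> (\<rho> i)) t"
proof -
  have up: "(\<lambda>i. up_subst \<sigma> (up_ren \<rho> i)) = up_subst (\<lambda>i. \<sigma> (\<rho> i))" for \<sigma> \<rho>
    by (auto simp: up_subst_def up_ren_def fun_eq_iff split: nat.split)
  show ?thesis by (induction t arbitrary: \<sigma> \<rho>) (simp_all add: up)
qed

lemma ren_ren: "ren \<rho> (ren \<rho>' t) = ren (\<lambda>i. \<rho> (\<rho>' i)) t"
  by (simp add: ren_eq_subst[of \<rho>] subst_ren) (simp add: ren_eq_subst)

lemma ren_subst: "ren \<rho> (subst \<sigma> t) = subst (\<lambda>i. ren \<rho> (\<sigma> i)) t"
proof -
  have up: "(\<lambda>i. ren (up_ren \<rho>) (up_subst \<sigma> i)) = up_subst (\<lambda>i. ren \<rho> (\<sigma> i))" for \<sigma> \<rho>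
    by (auto simp: up_subst_def up_ren_def lift_def ren_ren fun_eq_iff split: nat.split)
  show ?thesis by (induction t arbitrary: \<sigma> \<rho>) (simp_all add: up)
qed

text \<open>Under a binder, lifting must commute with substitution. Lifting is a renaming, so
  \<open>subst_ren\<close> and \<open>ren_subst\<close>, which have their own inductions, provide
  this.\<close>

lemma subst_subst: "subst \<sigma> (subst \<tau> t) = subst (subst_comp \<sigma> \<tau>) t"
proof -
  have up: "subst_comp (up_subst \<sigma>) (up_subst \<tau>) = up_subst (subst_comp \<sigma> \<tau>)" for \<sigma> \<tau>
    by (auto simp: up_subst_def subst_comp_def lift_def subst_ren ren_subst fun_eq_iff
        split: nat.split)
  show ?thesis
    by (induction t arbitrary: \<sigma> \<tau>) (simp_all add: up, simp add: subst_comp_def)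
qed

lemma lift_eq: "lift k t = t\<up>k"
  by (simp add: lift_def ren_eq_subst sh_def)

lemma scons_simps [simp]: "scons a \<sigma> 0 = a" "scons a \<sigma> (Suc i) = \<sigma> i"
  by (simp_all add: scons_def)

lemma up_subst_eq: "up_subst \<sigma> = scons (Var 0) (subst_comp (sh (Suc 0)) \<sigma>)"
  by (simp add: up_subst_def scons_def subst_comp_def lift_eq)

lemma subst_comp_Var: "subst_comp \<sigma> Var = \<sigma>" "subst_comp Var \<sigma> = \<sigma>"
  by (simp_all add: subst_comp_def)

lemma subst_comp_scons: "subst_comp \<sigma> (scons a \<tau>) = scons (subst \<sigma> a) (subst_comp \<sigma> \<tau>)"
  by (auto simp: subst_comp_def scons_def fun_eq_iff split: nat.split)

lemma subst_comp_assoc: "subst_comp (subst_comp \<sigma> \<tau>) \<upsilon> = subst_comp \<sigma> (subst_comp \<tau> \<upsilon>)"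
  by (simp add: subst_comp_def subst_subst)

lemma subst_comp_scons_sh: "subst_comp (scons a \<sigma>) (sh (Suc k)) = subst_comp \<sigma> (sh k)"
  by (simp add: subst_comp_def sh_def)

lemma subst_comp_sh_sh: "subst_comp (sh j) (sh k) = sh (k + j)"
  by (simp add: subst_comp_def sh_def add.assoc)

text \<open>\<open>subst_comp_assoc\<close> nests compositions to the right and so buries the redex
  of \<open>subst_comp_scons_sh\<close> under a further factor; this form and
  \<open>subst_comp_sh_sh'\<close> still find it.\<close>

lemma subst_comp_scons_sh': "subst_comp (scons a \<sigma>) (subst_comp (sh (Suc k)) \<tau>) = subst_comp \<sigma> (subst_comp (sh k) \<tau>)"
  by (simp add: subst_comp_scons_sh flip: subst_comp_assoc)

lemma subst_comp_sh_sh': "subst_comp (sh j) (subst_comp (sh k) \<tau>) = subst_comp (sh (k + j)) \<tau>"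
  by (simp add: subst_comp_sh_sh flip: subst_comp_assoc)

lemma sh_0: "sh 0 = Var"
  by (simp add: sh_def fun_eq_iff)

lemma sh_app: "sh k i = Var (i + k)"
  by (simp add: sh_def)

text \<open>Eta law for substitutions: without it a shift would have several normal forms, one for
  each number of leading variables split off.\<close>

lemma scons_Var_sh: "scons (Var k) (sh (Suc k)) = sh k"
  by (auto simp: scons_def sh_def fun_eq_iff split: nat.split)

lemma subst_comp_app: "subst_comp \<sigma> \<tau> i = subst \<sigma> (\<tau> i)"
  by (simp add: subst_comp_def)

lemma Var_plus_eq_sh: "(\<lambda>i. Var (i + k)) = sh k" "(\<lambda>i. Var (Suc i)) = sh (Suc 0)"
  "(\<lambda>i. Var (Suc (Suc i))) = sh (Suc (Suc 0))"
  by (simp_all add: sh_def)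

text \<open>Every substitution normalises to a list of \<open>scons\<close> ending in \<open>sh k\<close>, or in \<open>subst_comp \<sigma> (sh k)\<close>
  for a variable \<open>\<sigma>\<close>; numerals are unfolded because these rules recurse on \<open>Suc\<close>.\<close>

lemmas sigma_simps =
  subst_subst lift_eq up_subst_eq subst_comp_Var subst_comp_scons subst_comp_assoc
  subst_comp_scons_sh subst_comp_sh_sh subst_comp_scons_sh' subst_comp_sh_sh' subst_comp_app
  sh_0 sh_app scons_Var_sh scons_Var_sh[of 0, unfolded sh_0]
  inst1_def inst2_def inst3_def Var_plus_eq_sh numeral_eq_Suc

section \<open>Commutation of substitution with the operations that occur in the typing
  rules\<close>

lemma up_subst_0: "up_subst \<sigma> 0 = Var 0"
  by (simp add: up_subst_def)

lemma subst_up_lift: "subst (up_subst \<sigma>) (lift 1 t) = lift 1 (subst \<sigma> t)"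
  by (simp add: sigma_simps)

lemma subst_up_lift2:
  "subst (up_subst (up_subst \<sigma>)) (lift 2 t) = lift 2 (subst \<sigma> t)"
  by (simp add: sigma_simps)

lemma subst_inst1: "subst \<sigma> (inst1 t a) = inst1 (subst (up_subst \<sigma>) t) (subst \<sigma> a)"
  by (simp add: sigma_simps)

lemma subst_inst2:
  "subst \<sigma> (inst2 t a b) = inst2 (subst (up_subst (up_subst \<sigma>)) t) (subst \<sigma> a) (subst \<sigma> b)"
  by (simp add: sigma_simps)

lemma subst_inst3:
  "subst \<sigma> (inst3 t a b c) =
    inst3 (subst (up_subst (up_subst (up_subst \<sigma>))) t) (subst \<sigma> a) (subst \<sigma> b) (subst \<sigma> c)"
  by (simp add: sigma_simps)

lemma subst_Split_motive:
  "subst (up_subst (up_subst \<sigma>)) (subst (scons (MkPair (Var 1) (Var 0)) (\<lambda>i. Var (i + 2))) C) =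
   subst (scons (MkPair (Var 1) (Var 0)) (\<lambda>i. Var (i + 2))) (subst (up_subst \<sigma>) C)"
  by (simp add: sigma_simps)

lemma subst_J_motive:
  "subst (up_subst \<sigma>)
     (subst (scons (Refl (Var 0)) (scons (Var 0) (scons (Var 0) (\<lambda>i. Var (i + 1))))) C) =
   subst (scons (Refl (Var 0)) (scons (Var 0) (scons (Var 0) (\<lambda>i. Var (i + 1)))))
     (subst (up_subst (up_subst (up_subst \<sigma>))) C)"
  by (simp add: sigma_simps)

lemmas otm_defs = PI_def ARR_def LAM_def APP_def SIG_def PAIR_def SPLIT_def EQ_def PROJ1_def
  PROJ2_def COMP_def UU_def lvl_def

lemma subst_funext_type: "subst \<sigma> (funext_type i j) = funext_type i j"
  by (simp add: funext_type_def otm_defs sigma_simps)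

lemma subst_uip_type: "subst \<sigma> (uip_type i) = uip_type i"
  by (simp add: uip_type_def otm_defs sigma_simps)

lemmas subst_comms = up_subst_0 subst_up_lift subst_up_lift2 subst_inst1 subst_inst2 subst_inst3
  subst_Split_motive subst_J_motive subst_funext_type subst_uip_type

section \<open>Renaming and substitution\<close>

text \<open>One induction serves both renamings and typed substitutions; that the latter are closed under
  \<open>up_subst\<close> depends on the result for the former.\<close>

locale subst_kit =
  fixes K :: "(nat \<Rightarrow> tm) \<Rightarrow> tm list \<Rightarrow> tm list \<Rightarrow> bool"
  assumes kit_ctx: "K \<sigma> \<Gamma> \<Delta> \<Longrightarrow> ctx \<Delta>"
    and kit_Var: "K \<sigma> \<Gamma> \<Delta> \<Longrightarrow> i < length \<Gamma> \<Longrightarrow> \<Delta> \<turnstile> \<sigma> i \<Colon> subst \<sigma> (lift (Suc i) (\<Gamma> ! i))"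
    and kit_up: "K \<sigma> \<Gamma> \<Delta> \<Longrightarrow> \<Delta> \<turnstile> subst \<sigma> A \<Colon> Univ i \<Longrightarrow> K (up_subst \<sigma>) (A # \<Gamma>) (subst \<sigma> A # \<Delta>)"
begin

text \<open>Rules such as \<open>beta_Pi\<close> extend the context by a type without a premise typing it, so the
  induction must carry the claim for the types in the context as well.\<close>

primrec good_ctx :: "tm list \<Rightarrow> bool" where
  "good_ctx [] = True"
| "good_ctx (A # \<Gamma>) =
    (good_ctx \<Gamma> \<and> (\<exists>i. \<forall>\<sigma> \<Delta>. K \<sigma> \<Gamma> \<Delta> \<longrightarrow> \<Delta> \<turnstile> subst \<sigma> A \<Colon> Univ i))"

lemma good_ctx_up:
  assumes "good_ctx (A # \<Gamma>)" and "K \<sigma> \<Gamma> \<Delta>"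
  shows "K (up_subst \<sigma>) (A # \<Gamma>) (subst \<sigma> A # \<Delta>)"
  using assms by (fastforce intro: kit_up)

lemma good_ctx_up3:
  assumes "good_ctx (C # B # A # \<Gamma>)" and "K \<sigma> \<Gamma> \<Delta>"
  shows "K (up_subst (up_subst (up_subst \<sigma>))) (C # B # A # \<Gamma>)
      (subst (up_subst (up_subst \<sigma>)) C # subst (up_subst \<sigma>) B # subst \<sigma> A # \<Delta>)"
  using assms by (intro good_ctx_up) simp_all

text \<open>In the induction hypothesis for a branch the substitution is still quantified, so the
  commutation laws for motives fit only after it has been instantiated with a lifted one. As
  introduction rules they can act during proof search.\<close>

lemma motive_intros:
  "\<Delta> \<turnstile> d \<Colon> subst (up_subst (up_subst \<sigma>))
      (subst (scons (MkPair (Var 1) (Var 0)) (\<lambda>i. Var (i + 2))) C) \<Longrightarrow>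
    \<Delta> \<turnstile> d \<Colon> subst (scons (MkPair (Var 1) (Var 0)) (\<lambda>i. Var (i + 2))) (subst (up_subst \<sigma>) C)"
  "\<Delta> \<turnstile> d \<doteq> d' \<Colon> subst (up_subst (up_subst \<sigma>))
      (subst (scons (MkPair (Var 1) (Var 0)) (\<lambda>i. Var (i + 2))) C) \<Longrightarrow>
    \<Delta> \<turnstile> d \<doteq> d' \<Colon> subst (scons (MkPair (Var 1) (Var 0)) (\<lambda>i. Var (i + 2))) (subst (up_subst \<sigma>) C)"
  "\<Delta> \<turnstile> d \<Colon> subst (up_subst \<sigma>)
      (subst (scons (Refl (Var 0)) (scons (Var 0) (scons (Var 0) (\<lambda>i. Var (i + 1))))) C) \<Longrightarrow>
    \<Delta> \<turnstile> d \<Colon> subst (scons (Refl (Var 0)) (scons (Var 0) (scons (Var 0) (\<lambda>i. Var (i + 1)))))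
      (subst (up_subst (up_subst (up_subst \<sigma>))) C)"
  "\<Delta> \<turnstile> d \<doteq> d' \<Colon> subst (up_subst \<sigma>)
      (subst (scons (Refl (Var 0)) (scons (Var 0) (scons (Var 0) (\<lambda>i. Var (i + 1))))) C) \<Longrightarrow>
    \<Delta> \<turnstile> d \<doteq> d' \<Colon> subst (scons (Refl (Var 0)) (scons (Var 0) (scons (Var 0) (\<lambda>i. Var (i + 1)))))
      (subst (up_subst (up_subst (up_subst \<sigma>))) C)"
  by (simp_all only: subst_Split_motive subst_J_motive)

lemma good_ctx_tl: "good_ctx (A # \<Gamma>) \<Longrightarrow> good_ctx \<Gamma>"
  by simp

text \<open>The clause for contexts supplies \<open>good_ctx\<close> to the rules whose only
  judgement premise is a well-formed context.\<close>

lemma subst_preserves: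
  "ctx \<Gamma> \<Longrightarrow> good_ctx \<Gamma>"
  "\<Gamma> \<turnstile> t \<Colon> T \<Longrightarrow> good_ctx \<Gamma> \<and> (\<forall>\<sigma> \<Delta>. K \<sigma> \<Gamma> \<Delta> \<longrightarrow> \<Delta> \<turnstile> subst \<sigma> t \<Colon> subst \<sigma> T)"
  "\<Gamma> \<turnstile> t \<doteq> u \<Colon> T \<Longrightarrow>
    good_ctx \<Gamma> \<and> (\<forall>\<sigma> \<Delta>. K \<sigma> \<Gamma> \<Delta> \<longrightarrow> \<Delta> \<turnstile> subst \<sigma> t \<doteq> subst \<sigma> u \<Colon> subst \<sigma> T)"
proof (induction rule: ctx_has_type_jeq.inducts)
  case ctx_Nil
  then show ?case by simp
next
  case (ctx_Cons \<Gamma> A i)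
  then show ?case by auto
next
  case (ty_Var \<Gamma> i)
  then show ?case by (simp add: kit_Var)
next
  case ty_Conv
  then show ?case
    unfolding subst.simps subst_comms
    by (blast intro: ctx_has_type_jeq.ty_Conv kit_ctx good_ctx_up dest: good_ctx_tl)
next
  case ty_Univ
  then show ?case
    unfolding subst.simps subst_comms
    by (blast intro: ctx_has_type_jeq.ty_Univ kit_ctx good_ctx_up dest: good_ctx_tl)
next
  case ty_Pi
  then show ?case
    unfolding subst.simps subst_comms
    by (blast intro: ctx_has_type_jeq.ty_Pi kit_ctx good_ctx_up dest: good_ctx_tl)
next
  case ty_Lam
  then show ?case
    unfolding subst.simps subst_comms
    by (blast intro: ctx_has_type_jeq.ty_Lam kit_ctx good_ctx_up dest: good_ctx_tl)
next
  case ty_App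
  then show ?case
    unfolding subst.simps subst_comms
    by (blast intro: ctx_has_type_jeq.ty_App kit_ctx good_ctx_up dest: good_ctx_tl)
next
  case ty_Sig
  then show ?case
    unfolding subst.simps subst_comms
    by (blast intro: ctx_has_type_jeq.ty_Sig kit_ctx good_ctx_up dest: good_ctx_tl)
next
  case ty_MkPair
  then show ?case
    unfolding subst.simps subst_comms
    by (blast intro: ctx_has_type_jeq.ty_MkPair kit_ctx good_ctx_up dest: good_ctx_tl)
next
  case (ty_Split A B \<Gamma> C k d p)
  \<comment> \<open>That \<open>Sig A B\<close> is a type comes from the \<open>good_ctx\<close>
    part of the induction hypothesis for the motive. The substitution is pushed inside
    \<open>Sig\<close> to match the premise of the rule.\<close>
  have "K (up_subst \<sigma>) (Sig A B # \<Gamma>) (Sig (subst \<sigma> A) (subst (up_subst \<sigma>) B) # \<Delta>)"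
    if "K \<sigma> \<Gamma> \<Delta>" for \<sigma> \<Delta>
    using ty_Split.IH(1) good_ctx_up[OF _ that] by force
  with ty_Split show ?case
    unfolding subst.simps subst_comms
    by (blast intro: ctx_has_type_jeq.ty_Split motive_intros(1,2) good_ctx_up dest: good_ctx_tl)
next
  case ty_Eq
  then show ?case
    unfolding subst.simps subst_comms
    by (blast intro: ctx_has_type_jeq.ty_Eq kit_ctx good_ctx_up dest: good_ctx_tl)
next
  case ty_Refl
  then show ?case
    unfolding subst.simps subst_comms
    by (blast intro: ctx_has_type_jeq.ty_Refl kit_ctx good_ctx_up dest: good_ctx_tl)
next
  case (ty_J A \<Gamma> C k c a b p)
  \<comment> \<open>The three context entries are written with the substitution applied to
    \<open>A\<close> alone, as the rule for \<open>J\<close> over the substituted \<open>A\<close>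
    expects them.\<close>
  have "K (up_subst (up_subst (up_subst \<sigma>))) (Eq (lift 2 A) (Var 1) (Var 0) # lift 1 A # A # \<Gamma>)
      (Eq (lift 2 (subst \<sigma> A)) (Var 1) (Var 0) # lift 1 (subst \<sigma> A) # subst \<sigma> A # \<Delta>)"
    if "K \<sigma> \<Gamma> \<Delta>" for \<sigma> \<Delta>
    using ty_J.IH(1) good_ctx_up3[OF _ that] that by (force simp: sigma_simps simp del: good_ctx.simps)
  with ty_J show ?case
    unfolding subst.simps subst_comms
    by (blast intro: ctx_has_type_jeq.ty_J motive_intros(3,4) kit_ctx good_ctx_up dest: good_ctx_tl)
next
  case ty_FunExt
  then show ?case
    unfolding subst.simps subst_comms
    by (blast intro: ctx_has_type_jeq.ty_FunExt kit_ctx good_ctx_up dest: good_ctx_tl)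
next
  case ty_UIP
  then show ?case
    unfolding subst.simps subst_comms
    by (blast intro: ctx_has_type_jeq.ty_UIP kit_ctx good_ctx_up dest: good_ctx_tl)
next
  case eq_refl
  then show ?case
    unfolding subst.simps subst_comms
    by (blast intro: ctx_has_type_jeq.eq_refl kit_ctx good_ctx_up dest: good_ctx_tl)
next
  case eq_sym
  then show ?case
    unfolding subst.simps subst_comms
    by (blast intro: ctx_has_type_jeq.eq_sym kit_ctx good_ctx_up dest: good_ctx_tl)
next
  case eq_trans
  then show ?case
    unfolding subst.simps subst_comms
    by (blast intro: ctx_has_type_jeq.eq_trans kit_ctx good_ctx_up dest: good_ctx_tl)
next
  case eq_Conv
  then show ?case
    unfolding subst.simps subst_comms
    by (blast intro: ctx_has_type_jeq.eq_Conv kit_ctx good_ctx_up dest: good_ctx_tl)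
next
  case beta_Pi
  then show ?case
    unfolding subst.simps subst_comms
    by (blast intro: ctx_has_type_jeq.beta_Pi kit_ctx good_ctx_up dest: good_ctx_tl)
next
  case eta_Pi
  then show ?case
    unfolding subst.simps subst_comms
    by (blast intro: ctx_has_type_jeq.eta_Pi kit_ctx good_ctx_up dest: good_ctx_tl)
next
  case (beta_Sig A B \<Gamma> C k d a b)
  have "K (up_subst \<sigma>) (Sig A B # \<Gamma>) (Sig (subst \<sigma> A) (subst (up_subst \<sigma>) B) # \<Delta>)"
    if "K \<sigma> \<Gamma> \<Delta>" for \<sigma> \<Delta>
    using beta_Sig.IH(1) good_ctx_up[OF _ that] by force
  with beta_Sig show ?case
    unfolding subst.simps subst_comms
    by (blast intro: ctx_has_type_jeq.beta_Sig motive_intros(1,2) good_ctx_up dest: good_ctx_tl)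
next
  case (beta_Eq A \<Gamma> C k c a)
  have "K (up_subst (up_subst (up_subst \<sigma>))) (Eq (lift 2 A) (Var 1) (Var 0) # lift 1 A # A # \<Gamma>)
      (Eq (lift 2 (subst \<sigma> A)) (Var 1) (Var 0) # lift 1 (subst \<sigma> A) # subst \<sigma> A # \<Delta>)"
    if "K \<sigma> \<Gamma> \<Delta>" for \<sigma> \<Delta>
    using beta_Eq.IH(1) good_ctx_up3[OF _ that] that by (force simp: sigma_simps simp del: good_ctx.simps)
  with beta_Eq show ?case
    unfolding subst.simps subst_comms
    by (blast intro: ctx_has_type_jeq.beta_Eq motive_intros(3,4) kit_ctx good_ctx_up dest: good_ctx_tl)
next
  case cong_Pi
  then show ?case
    unfolding subst.simps subst_comms
    by (blast intro: ctx_has_type_jeq.cong_Pi kit_ctx good_ctx_up dest: good_ctx_tl)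
next
  case cong_Lam
  then show ?case
    unfolding subst.simps subst_comms
    by (blast intro: ctx_has_type_jeq.cong_Lam kit_ctx good_ctx_up dest: good_ctx_tl)
next
  case cong_App
  then show ?case
    unfolding subst.simps subst_comms
    by (blast intro: ctx_has_type_jeq.cong_App kit_ctx good_ctx_up dest: good_ctx_tl)
next
  case cong_Sig
  then show ?case
    unfolding subst.simps subst_comms
    by (blast intro: ctx_has_type_jeq.cong_Sig kit_ctx good_ctx_up dest: good_ctx_tl)
next
  case cong_MkPair
  then show ?case
    unfolding subst.simps subst_comms
    by (blast intro: ctx_has_type_jeq.cong_MkPair kit_ctx good_ctx_up dest: good_ctx_tl)
next
  case (cong_Split A B \<Gamma> C C' k d d' p p')
  have "K (up_subst \<sigma>) (Sig A B # \<Gamma>) (Sig (subst \<sigma> A) (subst (up_subst \<sigma>) B) # \<Delta>)"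
    if "K \<sigma> \<Gamma> \<Delta>" for \<sigma> \<Delta>
    using cong_Split.IH(1) good_ctx_up[OF _ that] by force
  with cong_Split show ?case
    unfolding subst.simps subst_comms
    by (blast intro: ctx_has_type_jeq.cong_Split motive_intros(1,2) good_ctx_up dest: good_ctx_tl)
next
  case cong_Eq
  then show ?case
    unfolding subst.simps subst_comms
    by (blast intro: ctx_has_type_jeq.cong_Eq kit_ctx good_ctx_up dest: good_ctx_tl)
next
  case cong_Refl
  then show ?case
    unfolding subst.simps subst_comms
    by (blast intro: ctx_has_type_jeq.cong_Refl kit_ctx good_ctx_up dest: good_ctx_tl)
next
  case (cong_J A \<Gamma> C C' k c c' a a' b b' p p')
  have "K (up_subst (up_subst (up_subst \<sigma>))) (Eq (lift 2 A) (Var 1) (Var 0) # lift 1 A # A # \<Gamma>)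
      (Eq (lift 2 (subst \<sigma> A)) (Var 1) (Var 0) # lift 1 (subst \<sigma> A) # subst \<sigma> A # \<Delta>)"
    if "K \<sigma> \<Gamma> \<Delta>" for \<sigma> \<Delta>
    using cong_J.IH(1) good_ctx_up3[OF _ that] that by (force simp: sigma_simps simp del: good_ctx.simps)
  with cong_J show ?case
    unfolding subst.simps subst_comms
    by (blast intro: ctx_has_type_jeq.cong_J motive_intros(3,4) kit_ctx good_ctx_up dest: good_ctx_tl)
qed

end

text \<open>The condition on variables is an equation between context entries, not a typing
  judgement. It therefore passes under a binder by calculation alone, before weakening is
  available.\<close>

definition renaming :: "(nat \<Rightarrow> tm) \<Rightarrow> tm list \<Rightarrow> tm list \<Rightarrow> bool" where
  "renaming \<sigma> \<Gamma> \<Delta> \<longleftrightarrow> ctx \<Delta> \<and> (\<exists>\<rho>. \<sigma> = (\<lambda>i. Var (\<rho> i)) \<and>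
    (\<forall>i<length \<Gamma>. \<rho> i < length \<Delta> \<and>
      lift (Suc (\<rho> i)) (\<Delta> ! \<rho> i) = subst \<sigma> (lift (Suc i) (\<Gamma> ! i))))"

definition substitution :: "(nat \<Rightarrow> tm) \<Rightarrow> tm list \<Rightarrow> tm list \<Rightarrow> bool" where
  "substitution \<sigma> \<Gamma> \<Delta> \<longleftrightarrow>
    ctx \<Delta> \<and> (\<forall>i<length \<Gamma>. \<Delta> \<turnstile> \<sigma> i \<Colon> subst \<sigma> (lift (Suc i) (\<Gamma> ! i)))"

interpretation renaming: subst_kit renaming
proof
  fix \<sigma> \<Gamma> \<Delta> i
  assume "renaming \<sigma> \<Gamma> \<Delta>" "i < length \<Gamma>"
  then show "\<Delta> \<turnstile> \<sigma> i \<Colon> subst \<sigma> (lift (Suc i) (\<Gamma> ! i))"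
    using ty_Var unfolding renaming_def by fastforce
next
  fix \<sigma> \<Gamma> \<Delta> A i
  assume "renaming \<sigma> \<Gamma> \<Delta>" and A: "\<Delta> \<turnstile> subst \<sigma> A \<Colon> Univ i"
  then obtain \<rho> where \<sigma>: "\<sigma> = (\<lambda>i. Var (\<rho> i))"
    and \<rho>: "\<And>i. i < length \<Gamma> \<Longrightarrow> \<rho> i < length \<Delta> \<and>
      lift (Suc (\<rho> i)) (\<Delta> ! \<rho> i) = subst \<sigma> (lift (Suc i) (\<Gamma> ! i))"
    by (auto simp: renaming_def)
  have "up_ren \<rho> i < length (subst \<sigma> A # \<Delta>) \<and>
      lift (Suc (up_ren \<rho> i)) ((subst \<sigma> A # \<Delta>) ! up_ren \<rho> i) =
      subst (up_subst \<sigma>) (lift (Suc i) ((A # \<Gamma>) ! i))" if "i < length (A # \<Gamma>)" for i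
  proof (cases i)
    case 0
    then show ?thesis by (simp add: up_ren_def sigma_simps)
  next
    case (Suc j)
    have "(lift (Suc (\<rho> j)) (\<Delta> ! \<rho> j))\<up>(Suc 0) =
        (subst \<sigma> (lift (Suc j) (\<Gamma> ! j)))\<up>(Suc 0)"
      using \<rho>[of j] that Suc by simp
    moreover have "\<rho> j < length \<Delta>"
      using \<rho>[of j] that Suc by simp
    ultimately show ?thesis using Suc by (simp add: up_ren_def sigma_simps)
  qed
  moreover have "up_subst \<sigma> = (\<lambda>i. Var (up_ren \<rho> i))"
    by (simp add: \<sigma> up_subst_Var)
  ultimately show "renaming (up_subst \<sigma>) (A # \<Gamma>) (subst \<sigma> A # \<Delta>)"
    using ctx_Cons[OF A] unfolding renaming_def by blast
qed (simp add: renaming_def)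

lemma weaken1:
  assumes "\<Gamma> \<turnstile> C \<Colon> Univ i" and "\<Gamma> \<turnstile> a \<Colon> A"
  shows "C # \<Gamma> \<turnstile> a\<up>(Suc 0) \<Colon> A\<up>(Suc 0)"
proof -
  have "renaming (sh (Suc 0)) \<Gamma> (C # \<Gamma>)"
    unfolding renaming_def using ctx_Cons[OF assms(1)]
    by (auto simp: sigma_simps intro!: exI[of _ Suc])
  then show ?thesis
    using renaming.subst_preserves(2)[OF assms(2)] by blast
qed

interpretation substitution: subst_kit substitution
proof
  fix \<sigma> \<Gamma> \<Delta> A i
  assume \<sigma>: "substitution \<sigma> \<Gamma> \<Delta>" and A: "\<Delta> \<turnstile> subst \<sigma> A \<Colon> Univ i"
  have "subst \<sigma> A # \<Delta> \<turnstile> up_subst \<sigma> i \<Colon> subst (up_subst \<sigma>) (lift (Suc i) ((A # \<Gamma>) ! i))"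
    if "i < length (A # \<Gamma>)" for i
  proof (cases i)
    case 0
    then show ?thesis
      using ty_Var[OF ctx_Cons[OF A], of 0] by (simp add: sigma_simps)
  next
    case (Suc j)
    then have "\<Delta> \<turnstile> \<sigma> j \<Colon> subst \<sigma> (lift (Suc j) (\<Gamma> ! j))"
      using \<sigma> that by (simp add: substitution_def)
    from weaken1[OF A this] show ?thesis by (simp add: Suc sigma_simps)
  qed
  then show "substitution (up_subst \<sigma>) (A # \<Gamma>) (subst \<sigma> A # \<Delta>)"
    using ctx_Cons[OF A] by (simp add: substitution_def)
qed (simp_all add: substitution_def)

lemma has_type_ctx:
  shows "\<Gamma> \<turnstile> t \<Colon> T \<Longrightarrow> ctx \<Gamma>" and "\<Gamma> \<turnstile> t \<doteq> u \<Colon> T \<Longrightarrow> ctx \<Gamma>"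
  by (induction rule: ctx_has_type_jeq.inducts(2,3)[where ?P1.0 = "\<lambda>_. True"]) auto

lemma substitution_Var: "ctx \<Gamma> \<Longrightarrow> substitution Var \<Gamma> \<Gamma>"
  by (auto simp: substitution_def intro: ty_Var)

lemma substitution_scons:
  "substitution \<sigma> \<Gamma> \<Delta> \<Longrightarrow> \<Delta> \<turnstile> a \<Colon> subst \<sigma> A \<Longrightarrow> substitution (scons a \<sigma>) (A # \<Gamma>) \<Delta>"
  by (auto simp: substitution_def less_Suc_eq_0_disj sigma_simps)

lemma has_type_subst:
  "\<Gamma> \<turnstile> t \<Colon> T \<Longrightarrow> substitution \<sigma> \<Gamma> \<Delta> \<Longrightarrow> \<Delta> \<turnstile> subst \<sigma> t \<Colon> subst \<sigma> T"
  using substitution.subst_preserves(2) by blast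

lemma substitution_sh: "ctx \<Delta> \<Longrightarrow> substitution (sh k) (drop k \<Delta>) \<Delta>"
  unfolding substitution_def using ty_Var[of \<Delta>]
  by (auto simp: sigma_simps add.commute)

text \<open>With \<open>drop\<close> the number of skipped binders determines the smaller context,
  so a shift past several binders is a single step.\<close>

lemma weaken:
  assumes "ctx \<Delta>" and "drop k \<Delta> \<turnstile> a \<Colon> A"
  shows "\<Delta> \<turnstile> a\<up>k \<Colon> A\<up>k"
  using assms has_type_subst substitution_sh by blast

lemma substitution_inst1: "\<Gamma> \<turnstile> a \<Colon> A \<Longrightarrow> substitution (scons a Var) (A # \<Gamma>) \<Gamma>"
  by (simp add: substitution_scons substitution_Var has_type_ctx)

lemma has_type_inst1:
  "A # \<Gamma> \<turnstile> b \<Colon> B \<Longrightarrow> \<Gamma> \<turnstile> a \<Colon> A \<Longrightarrow> \<Gamma> \<turnstile> inst1 b a \<Colon> inst1 B a"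
  unfolding inst1_def by (rule has_type_subst[OF _ substitution_inst1])

section \<open>Derived rules\<close>

text \<open>Stands in for a general regularity theorem: where the universe of a type is not a
  premise, it is read off from a well-formed context containing the type.\<close>

lemma ctx_ConsE:
  assumes "ctx (A # \<Gamma>)"
  obtains i where "\<Gamma> \<turnstile> A \<Colon> Univ i"
  using assms by (cases rule: ctx.cases) auto

text \<open>Here and in \<open>App_type\<close>, \<open>App_cong\<close> and \<open>Pi_beta\<close>
  the shifted or instantiated type is a variable with an equation as premise. The rule then fits a
  type in any syntactic form, and the substitution calculus settles the equation.\<close>

lemma Var_type:
  "ctx \<Gamma> \<Longrightarrow> i < length \<Gamma> \<Longrightarrow> (\<Gamma> ! i)\<up>(Suc i) = T \<Longrightarrow> \<Gamma> \<turnstile> Var i \<Colon> T"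
  using ty_Var[of \<Gamma> i] by (simp add: lift_eq)

lemma App_type: "\<Gamma> \<turnstile> f \<Colon> Pi A B \<Longrightarrow> \<Gamma> \<turnstile> a \<Colon> A \<Longrightarrow> inst1 B a = T \<Longrightarrow> \<Gamma> \<turnstile> App f a \<Colon> T"
  using ty_App by blast

text \<open>The impredicative instance of the product rule: the level \<open>i\<close> of the domain
  is arbitrary.\<close>

lemma Pi_type: "\<Gamma> \<turnstile> A \<Colon> Univ i \<Longrightarrow> A # \<Gamma> \<turnstile> B \<Colon> Univ 0 \<Longrightarrow> \<Gamma> \<turnstile> Pi A B \<Colon> Univ 0"
  using ty_Pi[of \<Gamma> A i B 0] by (simp add: pi_level_def)

lemma App_cong:
  "\<Gamma> \<turnstile> f \<doteq> f' \<Colon> Pi A B \<Longrightarrow> \<Gamma> \<turnstile> a \<doteq> a' \<Colon> A \<Longrightarrow> inst1 B a = T \<Longrightarrow> \<Gamma> \<turnstile> App f a \<doteq> App f' a' \<Colon> T"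
  using cong_App by blast

lemma Pi_beta:
  "A # \<Gamma> \<turnstile> b \<Colon> B \<Longrightarrow> \<Gamma> \<turnstile> a \<Colon> A \<Longrightarrow> inst1 b a = u \<Longrightarrow> inst1 B a = T \<Longrightarrow> \<Gamma> \<turnstile> App (Lam A b) a \<doteq> u \<Colon> T"
  using beta_Pi by blast

text \<open>Congruence of an arbitrary term former, obtained by beta-expanding both sides.\<close>

lemma inst1_cong:
  assumes t: "A # \<Gamma> \<turnstile> t \<Colon> T\<up>(Suc 0)"
    and eq: "\<Gamma> \<turnstile> a \<doteq> b \<Colon> A" and a: "\<Gamma> \<turnstile> a \<Colon> A" and b: "\<Gamma> \<turnstile> b \<Colon> A"
  shows "\<Gamma> \<turnstile> inst1 t a \<doteq> inst1 t b \<Colon> T"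
proof -
  obtain i where A: "\<Gamma> \<turnstile> A \<Colon> Univ i"
    using has_type_ctx(1)[OF t] by (rule ctx_ConsE)
  have T: "inst1 (T\<up>(Suc 0)) c = T" for c
    by (simp add: sigma_simps)
  have "\<Gamma> \<turnstile> App (Lam A t) a \<doteq> App (Lam A t) b \<Colon> T"
    by (rule App_cong[OF eq_refl[OF ty_Lam[OF A t]] eq T])
  moreover have "\<Gamma> \<turnstile> App (Lam A t) c \<doteq> inst1 t c \<Colon> T" if "\<Gamma> \<turnstile> c \<Colon> A" for c
    by (rule Pi_beta[OF t that refl T])
  ultimately show ?thesis
    using a b by (meson eq_sym eq_trans)
qed

lemma inst1_type_cong:
  assumes "A # \<Gamma> \<turnstile> C \<Colon> Univ k" "\<Gamma> \<turnstile> a \<doteq> b \<Colon> A" "\<Gamma> \<turnstile> a \<Colon> A" "\<Gamma> \<turnstile> b \<Colon> A"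
  shows "\<Gamma> \<turnstile> inst1 C a \<doteq> inst1 C b \<Colon> Univ k"
  by (rule inst1_cong[where T = "Univ k"]) (use assms in simp_all)

section \<open>Dependent projections, their typing and their computation rules\<close>

definition pr1 :: "tm \<Rightarrow> tm \<Rightarrow> tm" where
  "pr1 A p = Split A\<up>1 (Var 1) p"

definition pr2 :: "tm \<Rightarrow> tm \<Rightarrow> tm \<Rightarrow> tm" where
  "pr2 A B p = Split (subst (scons (pr1 A\<up>1 (Var 0)) (sh 1)) B) (Var 0) p"

lemma subst_pr1: "subst \<sigma> (pr1 A p) = pr1 (subst \<sigma> A) (subst \<sigma> p)"
  by (simp add: pr1_def sigma_simps)

context
  fixes \<Gamma> A B i j
  assumes A: "\<Gamma> \<turnstile> A \<Colon> Univ i" and B: "A # \<Gamma> \<turnstile> B \<Colon> Univ j"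
begin

lemma ctx_Sig: "ctx (Sig A B # \<Gamma>)" "ctx (A # \<Gamma>)" "ctx (B # A # \<Gamma>)"
  using ctx_Cons ty_Sig[OF A B] A B by blast+

lemma pr1_type:
  assumes "\<Gamma> \<turnstile> p \<Colon> Sig A B"
  shows "\<Gamma> \<turnstile> pr1 A p \<Colon> A"
proof -
  have "\<Gamma> \<turnstile> pr1 A p \<Colon> inst1 A\<up>1 p"
    unfolding pr1_def
  proof (rule ty_Split[OF _ _ assms])
    show "Sig A B # \<Gamma> \<turnstile> A\<up>1 \<Colon> Univ i"
      using weaken[OF ctx_Sig(1), of 1] A by fastforce
    show "B # A # \<Gamma> \<turnstile> Var 1 \<Colon> subst (scons (MkPair (Var 1) (Var 0)) (\<lambda>i. Var (i + 2))) A\<up>1"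
      by (rule Var_type) (simp_all add: ctx_Sig sigma_simps)
  qed
  then show ?thesis by (simp add: sigma_simps)
qed

lemma pr1_beta:
  assumes "\<Gamma> \<turnstile> a \<Colon> A" "\<Gamma> \<turnstile> b \<Colon> inst1 B a"
  shows "\<Gamma> \<turnstile> pr1 A (MkPair a b) \<doteq> a \<Colon> A"
proof -
  have "\<Gamma> \<turnstile> pr1 A (MkPair a b) \<doteq> inst2 (Var 1) a b \<Colon> inst1 A\<up>1 (MkPair a b)"
    unfolding pr1_def
  proof (rule beta_Sig[OF _ _ assms])
    show "Sig A B # \<Gamma> \<turnstile> A\<up>1 \<Colon> Univ i"
      using weaken[OF ctx_Sig(1), of 1] A by fastforce
    show "B # A # \<Gamma> \<turnstile> Var 1 \<Colon> subst (scons (MkPair (Var 1) (Var 0)) (\<lambda>i. Var (i + 2))) A\<up>1"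
      by (rule Var_type) (simp_all add: ctx_Sig sigma_simps)
  qed
  then show ?thesis by (simp add: sigma_simps)
qed

end

text \<open>Weakening below one binder; \<open>scons (Var 0) (sh (Suc k))\<close> is the normal form
  of \<open>up_subst (sh k)\<close>.\<close>

lemma has_type_shift1:
  assumes "A # \<Gamma> \<turnstile> b \<Colon> B" and "\<Gamma> = drop k \<Delta>" and "ctx \<Delta>"
  shows "A\<up>k # \<Delta> \<turnstile> subst (scons (Var 0) (sh (Suc k))) b \<Colon> subst (scons (Var 0) (sh (Suc k))) B"
proof -
  obtain i where A: "\<Gamma> \<turnstile> A \<Colon> Univ i"
    using has_type_ctx(1)[OF assms(1)] by (rule ctx_ConsE)
  have "substitution (sh k) \<Gamma> \<Delta>"
    using substitution_sh assms by simp
  moreover have "\<Delta> \<turnstile> A\<up>k \<Colon> Univ i"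
    using weaken[OF assms(3), of k A "Univ i"] A assms(2) by simp
  ultimately have "substitution (up_subst (sh k)) (A # \<Gamma>) (A\<up>k # \<Delta>)"
    by (rule substitution.kit_up)
  from has_type_subst[OF assms(1) this] show ?thesis
    by (simp add: sigma_simps)
qed

context
  fixes \<Gamma> A B i j
  assumes A: "\<Gamma> \<turnstile> A \<Colon> Univ i" and B: "A # \<Gamma> \<turnstile> B \<Colon> Univ j"
begin

lemma Sig_shift:
  assumes "ctx \<Delta>" "\<Gamma> = drop k \<Delta>"
  shows "\<Delta> \<turnstile> A\<up>k \<Colon> Univ i"
    and "A\<up>k # \<Delta> \<turnstile> subst (scons (Var 0) (sh (Suc k))) B \<Colon> Univ j"
  using weaken[OF assms(1), of k A "Univ i"] has_type_shift1[OF B assms(2,1)] A assms(2) by simp_all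

lemma pr2_motive:
  "Sig A B # \<Gamma> \<turnstile> subst (scons (pr1 A\<up>1 (Var 0)) (sh 1)) B \<Colon> Univ j"
proof -
  note ctx = ctx_Sig(1)[OF A B]
  note AB = Sig_shift[OF ctx, of 1]
  have "Sig A B # \<Gamma> \<turnstile> pr1 A\<up>1 (Var 0) \<Colon> A\<up>1"
    by (rule pr1_type[OF AB]) (auto intro!: Var_type simp: ctx sigma_simps)
  from has_type_inst1[OF AB(2) this] show ?thesis
    by (simp add: sigma_simps)
qed

text \<open>In the branch the second component has type \<open>B\<close> at index 1, while the
  motive asks for \<open>B\<close> at the first projection of the rebuilt pair;
  \<open>pr1_beta\<close> makes the two types judgementally equal.\<close>

lemma pr2_branch:
  "B # A # \<Gamma> \<turnstile> Var 0 \<Colon> subst (scons (MkPair (Var 1) (Var 0)) (\<lambda>i. Var (i + 2)))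
     (subst (scons (pr1 A\<up>1 (Var 0)) (sh 1)) B)"
proof -
  note ctx = ctx_Sig(3)[OF A B]
  let ?A = "A\<up>2" and ?B = "subst (scons (Var 0) (sh 3)) B"
  have AB: "B # A # \<Gamma> \<turnstile> ?A \<Colon> Univ i" "?A # B # A # \<Gamma> \<turnstile> ?B \<Colon> Univ j"
    using Sig_shift[OF ctx, of 2] by (simp_all add: numeral_eq_Suc)
  have 1: "B # A # \<Gamma> \<turnstile> Var 1 \<Colon> ?A"
    by (rule Var_type) (simp_all add: ctx sigma_simps)
  have 0: "B # A # \<Gamma> \<turnstile> Var 0 \<Colon> inst1 ?B (Var 1)"
    by (rule Var_type) (simp_all add: ctx sigma_simps)
  have "B # A # \<Gamma> \<turnstile> inst1 ?B (Var 1) \<doteq> inst1 ?B (pr1 ?A (MkPair (Var 1) (Var 0))) \<Colon> Univ j"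
    by (rule inst1_type_cong[OF AB(2) eq_sym[OF pr1_beta[OF AB 1 0]] 1
          pr1_type[OF AB ty_MkPair[OF AB(2) 1 0]]])
  from ty_Conv[OF 0 this] show ?thesis
    by (simp add: sigma_simps subst_pr1)
qed

lemma pr2_type:
  assumes "\<Gamma> \<turnstile> p \<Colon> Sig A B"
  shows "\<Gamma> \<turnstile> pr2 A B p \<Colon> inst1 B (pr1 A p)"
  using ty_Split[OF pr2_motive pr2_branch assms] by (simp add: pr2_def sigma_simps subst_pr1)

lemma pr2_beta:
  assumes "\<Gamma> \<turnstile> a \<Colon> A" "\<Gamma> \<turnstile> b \<Colon> inst1 B a"
  shows "\<Gamma> \<turnstile> pr2 A B (MkPair a b) \<doteq> b \<Colon> inst1 B (pr1 A (MkPair a b))"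
  using beta_Sig[OF pr2_motive pr2_branch assms] by (simp add: pr2_def sigma_simps subst_pr1)

end

lemma subst_pr2: "subst \<sigma> (pr2 A B p) = pr2 (subst \<sigma> A) (subst (up_subst \<sigma>) B) (subst \<sigma> p)"
  by (simp add: pr2_def sigma_simps subst_pr1)

section \<open>Propositional reasoning\<close>

text \<open>Open-context form of \<open>inhabited\<close>. Since only inhabitation is claimed in the
  end, proofs of identity types are handled by their existence and never written out.\<close>

definition inh :: "tm list \<Rightarrow> tm \<Rightarrow> bool" where
  "inh \<Gamma> T \<longleftrightarrow> (\<exists>t. \<Gamma> \<turnstile> t \<Colon> T)"

lemma inhI: "\<Gamma> \<turnstile> t \<Colon> T \<Longrightarrow> inh \<Gamma> T"
  by (auto simp: inh_def)

lemma inh_Pi: "\<Gamma> \<turnstile> A \<Colon> Univ i \<Longrightarrow> inh (A # \<Gamma>) B \<Longrightarrow> inh \<Gamma> (Pi A B)"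
  unfolding inh_def using ty_Lam by blast

lemma inh_App: "inh \<Gamma> (Pi A B) \<Longrightarrow> \<Gamma> \<turnstile> a \<Colon> A \<Longrightarrow> inst1 B a = T \<Longrightarrow> inh \<Gamma> T"
  unfolding inh_def using App_type by blast

lemma inh_conv: "inh \<Gamma> A \<Longrightarrow> \<Gamma> \<turnstile> A \<doteq> B \<Colon> Univ i \<Longrightarrow> inh \<Gamma> B"
  unfolding inh_def using ty_Conv by blast

lemma inh_weaken: "ctx \<Delta> \<Longrightarrow> inh (drop k \<Delta>) T \<Longrightarrow> inh \<Delta> T\<up>k"
  unfolding inh_def using weaken by blast

lemma inh_Refl: "\<Gamma> \<turnstile> a \<Colon> A \<Longrightarrow> inh \<Gamma> (Eq A a a)"
  using inhI ty_Refl by blast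

text \<open>The motive of \<open>J\<close> is the function type from \<open>C\<close> at the left
  end point to \<open>C\<close> at the right one, so on the diagonal the identity function
  suffices.\<close>

lemma inh_transport:
  assumes eq: "inh \<Gamma> (Eq A a b)" and a: "\<Gamma> \<turnstile> a \<Colon> A" and b: "\<Gamma> \<turnstile> b \<Colon> A"
    and C: "A # \<Gamma> \<turnstile> C \<Colon> Univ k" and c: "inh \<Gamma> (inst1 C a)"
  shows "inh \<Gamma> (inst1 C b)"
proof -
  obtain p c where p: "\<Gamma> \<turnstile> p \<Colon> Eq A a b" and c: "\<Gamma> \<turnstile> c \<Colon> inst1 C a"
    using eq c by (auto simp: inh_def)
  obtain i where A: "\<Gamma> \<turnstile> A \<Colon> Univ i"
    using has_type_ctx(1)[OF C] by (rule ctx_ConsE)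
  let ?\<Delta> = "Eq (lift 2 A) (Var 1) (Var 0) # lift 1 A # A # \<Gamma>"
  have ctx1: "ctx (A # \<Gamma>)" using ctx_Cons[OF A] .
  have A1: "A # \<Gamma> \<turnstile> lift 1 A \<Colon> Univ i"
    using weaken[OF ctx1, of 1 A "Univ i"] A by (simp add: lift_eq)
  note ctx2 = ctx_Cons[OF A1]
  have A2: "lift 1 A # A # \<Gamma> \<turnstile> lift 2 A \<Colon> Univ i"
    using weaken[OF ctx2, of 2 A "Univ i"] A by (simp add: lift_eq)
  have "lift 1 A # A # \<Gamma> \<turnstile> Eq (lift 2 A) (Var 1) (Var 0) \<Colon> Univ i"
    by (rule ty_Eq[OF A2]; rule Var_type[OF ctx2]) (simp_all add: sigma_simps)
  note ctx3 = ctx_Cons[OF this]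
  have C': "?\<Delta> \<turnstile> subst (scons (Var 2) (sh 3)) C \<Colon> Univ k"
  proof -
    have "?\<Delta> \<turnstile> Var 2 \<Colon> A\<up>3"
      by (rule Var_type[OF ctx3]) (simp_all add: sigma_simps)
    then have "substitution (scons (Var 2) (sh 3)) (A # \<Gamma>) ?\<Delta>"
      using substitution_sh[OF ctx3, of 3] by (simp add: substitution_scons)
    from has_type_subst[OF C this] show ?thesis by simp
  qed
  note ctx4 = ctx_Cons[OF C']
  have D: "subst (scons (Var 2) (sh 3)) C # ?\<Delta> \<turnstile> subst (scons (Var 2) (sh 4)) C \<Colon> Univ k"
  proof -
    have "subst (scons (Var 2) (sh 3)) C # ?\<Delta> \<turnstile> Var 2 \<Colon> A\<up>4"
      by (rule Var_type[OF ctx4]) (simp_all add: sigma_simps)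
    then have "substitution (scons (Var 2) (sh 4)) (A # \<Gamma>) (subst (scons (Var 2) (sh 3)) C # ?\<Delta>)"
      using substitution_sh[OF ctx4, of 4] by (simp add: substitution_scons)
    from has_type_subst[OF C this] show ?thesis by simp
  qed
  \<comment> \<open>Both occurrences read \<open>Var 2\<close> but mean different end points: the
    domain names the left one, and in the codomain the product binder has moved the right one from
    index 1 to index 2.\<close>
  let ?M = "Pi (subst (scons (Var 2) (sh 3)) C) (subst (scons (Var 2) (sh 4)) C)"
  have "A # \<Gamma> \<turnstile> Lam C (Var 0) \<Colon> Pi C C\<up>1"
    by (rule ty_Lam[OF C], rule Var_type) (simp_all add: ctx_Cons[OF C])
  then have "\<Gamma> \<turnstile> J ?M (Lam C (Var 0)) a b p \<Colon> inst3 ?M a b p"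
    by (intro ty_J[OF ty_Pi[OF C' D] _ a b p]) (simp add: sigma_simps)
  then have "\<Gamma> \<turnstile> J ?M (Lam C (Var 0)) a b p \<Colon> Pi (inst1 C a) (subst (scons b\<up>1 (sh 1)) C)"
    by (simp add: sigma_simps)
  from App_type[OF this c] show ?thesis
    by (auto simp: sigma_simps intro: inhI)
qed

text \<open>There is no judgemental eta rule for \<open>Sig\<close>. On a canonical pair the two
  sides agree by the beta rules of the projections, and \<open>Split\<close> extends the identity to
  every \<open>p\<close>.\<close>

lemma inh_surjective_pairing:
  assumes A: "\<Gamma> \<turnstile> A \<Colon> Univ i" and B: "A # \<Gamma> \<turnstile> B \<Colon> Univ j" and p: "\<Gamma> \<turnstile> p \<Colon> Sig A B"
  shows "inh \<Gamma> (Eq (Sig A B) p (MkPair (pr1 A p) (pr2 A B p)))"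
proof -
  \<comment> \<open>The identity to be proved for \<open>z\<close>, read \<open>k\<close> binders
    deeper: \<open>k = 1\<close> gives the motive, \<open>k = 2\<close> the branch.\<close>
  define M where "M k z = (let A' = A\<up>k; B' = subst (scons (Var 0) (sh (Suc k))) B
    in Eq (Sig A' B') z (MkPair (pr1 A' z) (pr2 A' B' z)))" for k z
  have M: "\<Delta> \<turnstile> M k z \<Colon> Univ (max i j)"
    if "\<Delta> \<turnstile> z \<Colon> Sig A\<up>k (subst (scons (Var 0) (sh (Suc k))) B)" "\<Gamma> = drop k \<Delta>"
    for \<Delta> k z
  proof -
    note AB = Sig_shift[OF A B has_type_ctx(1)[OF that(1)] that(2)]
    show ?thesis
      unfolding M_def Let_def
      by (intro ty_Eq ty_Sig[OF AB] that(1) ty_MkPair[OF AB(2)] pr1_type[OF AB] pr2_type[OF AB])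
  qed
  note ctxs = ctx_Sig[OF A B]
  have "Sig A B # \<Gamma> \<turnstile> M 1 (Var 0) \<Colon> Univ (max i j)"
    by (rule M, rule Var_type[OF ctxs(1)]) (simp_all add: sigma_simps)
  moreover have "B # A # \<Gamma> \<turnstile> Refl (MkPair (Var 1) (Var 0)) \<Colon> M 2 (MkPair (Var 1) (Var 0))"
  proof -
    let ?A = "A\<up>2" and ?B = "subst (scons (Var 0) (sh 3)) B"
    let ?z = "MkPair (Var 1) (Var 0)"
    have AB: "B # A # \<Gamma> \<turnstile> ?A \<Colon> Univ i" "?A # B # A # \<Gamma> \<turnstile> ?B \<Colon> Univ j"
      using Sig_shift[OF A B ctxs(3), of 2] by (simp_all add: numeral_eq_Suc)
    have 1: "B # A # \<Gamma> \<turnstile> Var 1 \<Colon> ?A"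
      by (rule Var_type[OF ctxs(3)]) (simp_all add: sigma_simps)
    have 0: "B # A # \<Gamma> \<turnstile> Var 0 \<Colon> inst1 ?B (Var 1)"
      by (rule Var_type[OF ctxs(3)]) (simp_all add: sigma_simps)
    note z = ty_MkPair[OF AB(2) 1 0]
    have "B # A # \<Gamma> \<turnstile> inst1 ?B (pr1 ?A ?z) \<doteq> inst1 ?B (Var 1) \<Colon> Univ j"
      by (rule inst1_type_cong[OF AB(2) pr1_beta[OF AB 1 0] pr1_type[OF AB z] 1])
    \<comment> \<open>\<open>pr2_beta\<close> yields this at the type \<open>B\<close> of the first
      projection; \<open>cong_MkPair\<close> wants it at \<open>B\<close> of the first component,
      hence the conversion.\<close>
    then have "B # A # \<Gamma> \<turnstile> Var 0 \<doteq> pr2 ?A ?B ?z \<Colon> inst1 ?B (Var 1)"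
      using pr2_beta[OF AB 1 0] by (blast intro: eq_Conv eq_sym)
    then have "B # A # \<Gamma> \<turnstile> ?z \<doteq> MkPair (pr1 ?A ?z) (pr2 ?A ?B ?z) \<Colon> Sig ?A ?B"
      by (intro cong_MkPair[OF AB(2)] eq_sym[OF pr1_beta[OF AB 1 0]])
    from cong_Eq[OF eq_refl[OF ty_Sig[OF AB]] eq_refl[OF z] this]
    show ?thesis
      using ty_Refl[OF z] by (auto intro: ty_Conv simp: M_def Let_def numeral_eq_Suc)
  qed
  then have "B # A # \<Gamma> \<turnstile> Refl (MkPair (Var 1) (Var 0)) \<Colon>
      subst (scons (MkPair (Var 1) (Var 0)) (\<lambda>i. Var (i + 2))) (M 1 (Var 0))"
    by (simp add: M_def Let_def subst_pr1 subst_pr2 sigma_simps)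
  ultimately have "\<Gamma> \<turnstile> Split (M 1 (Var 0)) (Refl (MkPair (Var 1) (Var 0))) p \<Colon> inst1 (M 1 (Var 0)) p"
    using p by (rule ty_Split)
  then show ?thesis
    by (intro inhI) (simp add: M_def Let_def subst_pr1 subst_pr2 sigma_simps)
qed

section \<open>Laws of the identity type and identity of pairs\<close>

lemma inh_Eq_trans:
  assumes "inh \<Gamma> (Eq A a b)" "inh \<Gamma> (Eq A b c)"
    and "\<Gamma> \<turnstile> A \<Colon> Univ i" "\<Gamma> \<turnstile> a \<Colon> A" "\<Gamma> \<turnstile> b \<Colon> A" "\<Gamma> \<turnstile> c \<Colon> A"
  shows "inh \<Gamma> (Eq A a c)"
proof -
  let ?C = "Eq A\<up>1 a\<up>1 (Var 0)"
  have ctx: "ctx (A # \<Gamma>)" using assms ctx_Cons by blast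
  have "A # \<Gamma> \<turnstile> ?C \<Colon> Univ i"
    using weaken[OF ctx, of 1] assms by (force intro!: ty_Eq Var_type[OF ctx])
  from inh_transport[OF assms(2,5,6) this] assms(1) show ?thesis
    by (simp add: sigma_simps)
qed

lemma inh_Eq_sym:
  assumes "inh \<Gamma> (Eq A a b)" and "\<Gamma> \<turnstile> A \<Colon> Univ i" "\<Gamma> \<turnstile> a \<Colon> A" "\<Gamma> \<turnstile> b \<Colon> A"
  shows "inh \<Gamma> (Eq A b a)"
proof -
  let ?C = "Eq A\<up>1 (Var 0) a\<up>1"
  have ctx: "ctx (A # \<Gamma>)" using assms ctx_Cons by blast
  have "A # \<Gamma> \<turnstile> ?C \<Colon> Univ i"
    using weaken[OF ctx, of 1] assms by (force intro!: ty_Eq Var_type[OF ctx])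
  from inh_transport[OF assms(1,3,4) this] inh_Refl[OF assms(3)] show ?thesis
    by (simp add: sigma_simps)
qed

text \<open>The quantifiers range over terms of the single context \<open>\<Gamma>\<close>; a use
  under a binder thus needs the property in the extended context, as in
  \<open>inh_Eq_MkPair\<close>.\<close>

definition is_prop :: "tm list \<Rightarrow> tm \<Rightarrow> bool" where
  "is_prop \<Gamma> T \<longleftrightarrow> (\<forall>a b. \<Gamma> \<turnstile> a \<Colon> T \<longrightarrow> \<Gamma> \<turnstile> b \<Colon> T \<longrightarrow> inh \<Gamma> (Eq T a b))"

text \<open>\<open>u\<close> and \<open>v\<close> live in different fibres and cannot be compared
  directly. Quantifying over the second component removes the difficulty: what is transported from
  \<open>a\<close> to \<open>b\<close> is that the pair of \<open>a\<close> and \<open>u\<close>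
  equals the pair of x and y for all y in the fibre over x.\<close>

lemma inh_Eq_MkPair:
  assumes A: "\<Gamma> \<turnstile> A \<Colon> Univ i" and B: "A # \<Gamma> \<turnstile> B \<Colon> Univ j"
    and a: "\<Gamma> \<turnstile> a \<Colon> A" and b: "\<Gamma> \<turnstile> b \<Colon> A"
    and u: "\<Gamma> \<turnstile> u \<Colon> inst1 B a" and v: "\<Gamma> \<turnstile> v \<Colon> inst1 B b"
    and eq: "inh \<Gamma> (Eq A a b)" and isp: "is_prop (inst1 B a # \<Gamma>) ((inst1 B a)\<up>1)"
  shows "inh \<Gamma> (Eq (Sig A B) (MkPair a u) (MkPair b v))"
proof -
  define S where "S k = Sig A\<up>k (subst (scons (Var 0) (sh (Suc k))) B)" for k
  have S: "\<Delta> \<turnstile> S k \<Colon> Univ (max i j)" if "ctx \<Delta>" "\<Gamma> = drop k \<Delta>" for \<Delta> k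
    unfolding S_def by (rule ty_Sig[OF Sig_shift[OF A B that]])
  have pair: "\<Delta> \<turnstile> MkPair x y \<Colon> S k"
    if "\<Delta> \<turnstile> x \<Colon> A\<up>k" "\<Delta> \<turnstile> y \<Colon> subst (scons x (sh k)) B" "\<Gamma> = drop k \<Delta>" for \<Delta> k x y
    unfolding S_def
    by (rule ty_MkPair[OF Sig_shift(2)[OF A B has_type_ctx(1)[OF that(1)] that(3)] that(1)])
      (use that(2) in \<open>simp add: sigma_simps\<close>)
  note ctxs = ctx_Sig[OF A B]
  have au: "B # A # \<Gamma> \<turnstile> MkPair a\<up>2 u\<up>2 \<Colon> S 2"
    by (rule pair) (use weaken[OF ctxs(3), of 2] a u in \<open>force simp: sigma_simps\<close>)+
  have xy: "B # A # \<Gamma> \<turnstile> MkPair (Var 1) (Var 0) \<Colon> S 2"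
    by (rule pair; (rule Var_type[OF ctxs(3)])?) (simp_all add: sigma_simps)
  let ?C = "Pi B (Eq (S 2) (MkPair a\<up>2 u\<up>2) (MkPair (Var 1) (Var 0)))"
  have C: "A # \<Gamma> \<turnstile> ?C \<Colon> Univ (pi_level j (max i j))"
    by (rule ty_Pi[OF B ty_Eq[OF S au xy]]) (simp_all add: ctxs)
  let ?B = "inst1 B a"
  have B': "\<Gamma> \<turnstile> ?B \<Colon> Univ j"
    using has_type_inst1[OF B a] by (simp add: inst1_def)
  note ctx = ctx_Cons[OF B']
  have u': "?B # \<Gamma> \<turnstile> u\<up>1 \<Colon> ?B\<up>1"
    using weaken[OF ctx, of 1] u by force
  have v': "?B # \<Gamma> \<turnstile> Var 0 \<Colon> ?B\<up>1"
    by (rule Var_type[OF ctx]) (simp_all add: sigma_simps)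
  have B1: "?B # \<Gamma> \<turnstile> ?B\<up>1 \<Colon> Univ j"
    using weaken[OF ctx, of 1] B' by force
  note ctx2 = ctx_Cons[OF B1]
  \<comment> \<open>At x = \<open>a\<close> the second component y is a variable of the same fibre
    as \<open>u\<close>; this is why the fibre must be a proposition in the context extended by
    it.\<close>
  have "inh (?B # \<Gamma>) (Eq (?B\<up>1) u\<up>1 (Var 0))"
    using isp u' v' by (simp add: is_prop_def)
  moreover have "?B\<up>1 # ?B # \<Gamma> \<turnstile>
      Eq (S 2) (MkPair a\<up>2 u\<up>2) (MkPair a\<up>2 (Var 0)) \<Colon> Univ (max i j)"
    (is "_ \<turnstile> ?D \<Colon> _")
  proof (rule ty_Eq[OF S pair pair])
    show "?B\<up>1 # ?B # \<Gamma> \<turnstile> Var 0 \<Colon> subst (scons a\<up>2 (sh 2)) B"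
      by (rule Var_type[OF ctx2]) (simp_all add: sigma_simps)
  qed (use weaken[OF ctx2, of 2] a u ctx2 in \<open>force simp: sigma_simps\<close>)+
  moreover have "inh (?B # \<Gamma>) (inst1 ?D u\<up>1)"
  proof -
    have "?B # \<Gamma> \<turnstile> MkPair a\<up>1 u\<up>1 \<Colon> S 1"
      by (rule pair) (use weaken[OF ctx, of 1] a u in \<open>force simp: sigma_simps\<close>)+
    from inh_Refl[OF this] show ?thesis
      by (simp add: sigma_simps S_def)
  qed
  ultimately have "inh (?B # \<Gamma>) (inst1 ?D (Var 0))"
    using inh_transport u' v' by blast
  then have "inh \<Gamma> (inst1 ?C a)"
    using inh_Pi[OF B'] by (simp add: sigma_simps S_def)
  from inh_transport[OF eq a b C this]
  have "inh \<Gamma> (inst1 ?C b)" .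
  then have "inh \<Gamma> (Pi (inst1 B b) (Eq (S 1) (MkPair a\<up>1 u\<up>1) (MkPair b\<up>1 (Var 0))))"
    by (simp add: sigma_simps S_def)
  from inh_App[OF this v] show ?thesis
    by (simp add: sigma_simps S_def)
qed

text \<open>Propositional surjective pairing on both sides reduces the claim to literal
  pairs.\<close>

lemma inh_Eq_Sig:
  assumes A: "\<Gamma> \<turnstile> A \<Colon> Univ i" and B: "A # \<Gamma> \<turnstile> B \<Colon> Univ j"
    and p: "\<Gamma> \<turnstile> p \<Colon> Sig A B" and q: "\<Gamma> \<turnstile> q \<Colon> Sig A B"
    and eq: "inh \<Gamma> (Eq A (pr1 A p) (pr1 A q))"
    and isp: "is_prop (inst1 B (pr1 A p) # \<Gamma>) ((inst1 B (pr1 A p))\<up>1)"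
  shows "inh \<Gamma> (Eq (Sig A B) p q)"
proof -
  note S = ty_Sig[OF A B] and pr1 = pr1_type[OF A B] and pr2 = pr2_type[OF A B]
  note eta = inh_surjective_pairing[OF A B]
  have pair: "\<Gamma> \<turnstile> MkPair (pr1 A r) (pr2 A B r) \<Colon> Sig A B" if "\<Gamma> \<turnstile> r \<Colon> Sig A B" for r
    by (rule ty_MkPair[OF B pr1[OF that] pr2[OF that]])
  have "inh \<Gamma> (Eq (Sig A B) p (MkPair (pr1 A q) (pr2 A B q)))"
    by (rule inh_Eq_trans[OF eta[OF p] inh_Eq_MkPair[OF A B pr1[OF p] pr1[OF q] pr2[OF p] pr2[OF q] eq isp]
          S p pair[OF p] pair[OF q]])
  from inh_Eq_trans[OF this inh_Eq_sym[OF eta[OF q] S q pair[OF q]] S p pair[OF q] q]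
  show ?thesis .
qed

section \<open>Consequences of function extensionality and UIP\<close>

lemma funext_type_eq:
  "funext_type i j = Pi (Univ i) (Pi (Pi (Var 0) (Univ j))
    (Pi (Pi (Var 1) (App (Var 1) (Var 0))) (Pi (Pi (Var 2) (App (Var 2) (Var 0)))
    (Pi (Pi (Var 3) (Eq (App (Var 3) (Var 0)) (App (Var 2) (Var 0)) (App (Var 1) (Var 0))))
    (Eq (Pi (Var 4) (App (Var 4) (Var 0))) (Var 2) (Var 1))))))"
  by (simp add: funext_type_def otm_defs numeral_eq_Suc)

lemma uip_type_eq:
  "uip_type i = Pi (Univ i) (Pi (Var 0) (Pi (Var 1) (Pi (Eq (Var 2) (Var 1) (Var 0))
    (Pi (Eq (Var 3) (Var 2) (Var 1)) (Eq (Eq (Var 4) (Var 3) (Var 2)) (Var 1) (Var 0))))))"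
  by (simp add: uip_type_def otm_defs numeral_eq_Suc)

text \<open>\<open>FunExt\<close> takes a family as a function into a universe, whereas
  \<open>C\<close> is an open term. The axiom is used at \<open>Lam A C\<close>, and the types are
  converted between \<open>C\<close> and its beta-expansion \<open>?D\<close>.\<close>

lemma inh_funext:
  assumes A: "\<Gamma> \<turnstile> A \<Colon> Univ i" and C: "A # \<Gamma> \<turnstile> C \<Colon> Univ j"
    and f: "\<Gamma> \<turnstile> f \<Colon> Pi A C" and g: "\<Gamma> \<turnstile> g \<Colon> Pi A C"
    and eq: "inh (A # \<Gamma>) (Eq C (App f\<up>1 (Var 0)) (App g\<up>1 (Var 0)))"
  shows "inh \<Gamma> (Eq (Pi A C) f g)"
proof -
  note ctx = ctx_Cons[OF A]
  let ?D = "App (Lam A\<up>1 (subst (scons (Var 0) (sh 2)) C)) (Var 0)"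
  have C': "A\<up>1 # A # \<Gamma> \<turnstile> subst (scons (Var 0) (sh 2)) C \<Colon> Univ j"
    using has_type_shift1[OF C _ ctx, of 1] by (simp add: numeral_eq_Suc)
  have V: "A # \<Gamma> \<turnstile> Var 0 \<Colon> A\<up>1"
    by (rule Var_type[OF ctx]) simp_all
  have D: "A # \<Gamma> \<turnstile> C \<doteq> ?D \<Colon> Univ j"
    by (rule eq_sym, rule Pi_beta[OF C' V]) (simp_all add: sigma_simps)
  have PiD: "\<Gamma> \<turnstile> Pi A C \<doteq> Pi A ?D \<Colon> Univ (pi_level i j)"
    by (rule cong_Pi[OF A eq_refl[OF A] D])
  have App: "A # \<Gamma> \<turnstile> App h\<up>1 (Var 0) \<Colon> C" if "\<Gamma> \<turnstile> h \<Colon> Pi A C" for h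
  proof -
    have "A # \<Gamma> \<turnstile> h\<up>1 \<Colon> (Pi A C)\<up>1"
      using weaken[OF ctx, of 1] that by force
    then have "A # \<Gamma> \<turnstile> h\<up>1 \<Colon> Pi A\<up>1 (subst (scons (Var 0) (sh 2)) C)"
      by (simp add: sigma_simps)
    from App_type[OF this V] show ?thesis by (simp add: sigma_simps)
  qed
  have eq': "inh (A # \<Gamma>) (Eq ?D (App f\<up>1 (Var 0)) (App g\<up>1 (Var 0)))"
    by (rule inh_conv[OF eq]) (rule cong_Eq[OF D eq_refl[OF App[OF f]] eq_refl[OF App[OF g]]])
  have "inh \<Gamma> (funext_type i j)"
    by (rule inhI[OF ty_FunExt[OF has_type_ctx(1)[OF A]]])
  then have "inh \<Gamma> (Pi (Pi A (Univ j)) (Pi (Pi A\<up>1 (App (Var 1) (Var 0)))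
      (Pi (Pi A\<up>2 (App (Var 2) (Var 0)))
      (Pi (Pi A\<up>3 (Eq (App (Var 3) (Var 0)) (App (Var 2) (Var 0)) (App (Var 1) (Var 0))))
      (Eq (Pi A\<up>4 (App (Var 4) (Var 0))) (Var 2) (Var 1))))))"
    unfolding funext_type_eq by (rule inh_App[OF _ A]) (simp add: sigma_simps)
  \<comment> \<open>\<open>L\<close> stays folded while the axiom is instantiated, so the family is
    an atom for the substitution calculus; the fact \<open>L\<close> below identifies its
    application with \<open>?D\<close>.\<close>
  moreover define L where "L = Lam A C"
  then have "\<Gamma> \<turnstile> L \<Colon> Pi A (Univ j)"
    using ty_Lam[OF A C] by simp
  ultimately have S: "inh \<Gamma> (Pi (Pi A (App L\<up>1 (Var 0)))
      (Pi (Pi A\<up>1 (App L\<up>2 (Var 0)))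
      (Pi (Pi A\<up>2 (Eq (App L\<up>3 (Var 0)) (App (Var 2) (Var 0)) (App (Var 1) (Var 0))))
      (Eq (Pi A\<up>3 (App L\<up>4 (Var 0))) (Var 2) (Var 1)))))"
    by (rule inh_App) (simp add: sigma_simps)
  have L: "App L\<up>1 (Var 0) = ?D"
    by (simp add: L_def sigma_simps)
  then have fg: "\<Gamma> \<turnstile> f \<Colon> Pi A (App L\<up>1 (Var 0))" "\<Gamma> \<turnstile> g \<Colon> Pi A (App L\<up>1 (Var 0))"
    using ty_Conv[OF f PiD] ty_Conv[OF g PiD] by simp_all
  from S fg(1) have "inh \<Gamma> (Pi (Pi A (App L\<up>1 (Var 0)))
      (Pi (Pi A\<up>1 (Eq (App L\<up>2 (Var 0)) (App f\<up>2 (Var 0)) (App (Var 1) (Var 0))))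
      (Eq (Pi A\<up>2 (App L\<up>3 (Var 0))) f\<up>2 (Var 1))))"
    by (rule inh_App) (simp add: sigma_simps)
  then have "inh \<Gamma> (Pi (Pi A (Eq (App L\<up>1 (Var 0)) (App f\<up>1 (Var 0)) (App g\<up>1 (Var 0))))
      (Eq (Pi A\<up>1 (App L\<up>2 (Var 0))) f\<up>1 g\<up>1))"
    by (rule inh_App[OF _ fg(2)]) (simp add: sigma_simps)
  moreover obtain h where "\<Gamma> \<turnstile> h \<Colon> Pi A (Eq (App L\<up>1 (Var 0)) (App f\<up>1 (Var 0)) (App g\<up>1 (Var 0)))"
    using inh_Pi[OF A eq'] L by (auto simp: inh_def)
  ultimately have "inh \<Gamma> (Eq (Pi A (App L\<up>1 (Var 0))) f g)"
    by (rule inh_App) (simp add: sigma_simps)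
  then have "inh \<Gamma> (Eq (Pi A ?D) f g)"
    using L by simp
  then show ?thesis
    by (rule inh_conv) (rule eq_sym[OF cong_Eq[OF PiD eq_refl[OF f] eq_refl[OF g]]])
qed

lemma is_prop_Pi:
  assumes A: "\<Gamma> \<turnstile> A \<Colon> Univ i" and C: "A # \<Gamma> \<turnstile> C \<Colon> Univ j" and isp: "is_prop (A # \<Gamma>) C"
  shows "is_prop \<Gamma> (Pi A C)"
proof -
  note ctx = ctx_Cons[OF A]
  have "A # \<Gamma> \<turnstile> App h\<up>1 (Var 0) \<Colon> C" if "\<Gamma> \<turnstile> h \<Colon> Pi A C" for h
  proof -
    have "A # \<Gamma> \<turnstile> h\<up>1 \<Colon> (Pi A C)\<up>1"
      using weaken[OF ctx, of 1] that by force
    moreover have "A # \<Gamma> \<turnstile> Var 0 \<Colon> A\<up>1"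
      by (rule Var_type[OF ctx]) simp_all
    ultimately show ?thesis by (auto intro: App_type simp: sigma_simps)
  qed
  then show ?thesis
    using isp by (auto simp: is_prop_def intro!: inh_funext[OF A C])
qed

lemma is_prop_Eq:
  assumes A: "\<Gamma> \<turnstile> A \<Colon> Univ i" and a: "\<Gamma> \<turnstile> a \<Colon> A" and b: "\<Gamma> \<turnstile> b \<Colon> A"
  shows "is_prop \<Gamma> (Eq A a b)"
  unfolding is_prop_def
proof (intro allI impI)
  fix p q
  assume p: "\<Gamma> \<turnstile> p \<Colon> Eq A a b" and q: "\<Gamma> \<turnstile> q \<Colon> Eq A a b"
  have "inh \<Gamma> (uip_type i)"
    by (rule inhI[OF ty_UIP[OF has_type_ctx(1)[OF A]]])
  then have "inh \<Gamma> (Pi A (Pi A\<up>1 (Pi (Eq A\<up>2 (Var 1) (Var 0))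
    (Pi (Eq A\<up>3 (Var 2) (Var 1)) (Eq (Eq A\<up>4 (Var 3) (Var 2)) (Var 1) (Var 0))))))"
    unfolding uip_type_eq by (rule inh_App[OF _ A]) (simp add: sigma_simps)
  then have "inh \<Gamma> (Pi A (Pi (Eq A\<up>1 a\<up>1 (Var 0))
    (Pi (Eq A\<up>2 a\<up>2 (Var 1)) (Eq (Eq A\<up>3 a\<up>3 (Var 2)) (Var 1) (Var 0)))))"
    by (rule inh_App[OF _ a]) (simp add: sigma_simps)
  then have "inh \<Gamma> (Pi (Eq A a b)
    (Pi (Eq A\<up>1 a\<up>1 b\<up>1)
      (Eq (Eq A\<up>2 a\<up>2 b\<up>2) (Var 1) (Var 0))))"
    by (rule inh_App[OF _ b]) (simp add: sigma_simps)
  then have "inh \<Gamma> (Pi (Eq A a b) (Eq (Eq A\<up>1 a\<up>1 b\<up>1) p\<up>1 (Var 0)))"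
    by (rule inh_App[OF _ p]) (simp add: sigma_simps)
  then show "inh \<Gamma> (Eq (Eq A a b) p q)"
    by (rule inh_App[OF _ q]) (simp add: sigma_simps)
qed

section \<open>The encoded W-type over open terms\<close>

text \<open>These are the constructions of \<open>Defs\<close> with arbitrary raw terms as parameters; the shifts record
  the binders that a parameter is moved under.\<close>

definition AlgT :: "tm \<Rightarrow> tm \<Rightarrow> tm \<Rightarrow> tm" where
  "AlgT A B X = Pi A (Pi (Pi (App B\<up>1 (Var 0)) X\<up>2) X\<up>2)"

definition WstarT :: "tm \<Rightarrow> tm \<Rightarrow> tm" where
  "WstarT A B = Pi (Univ 0) (Pi (AlgT A\<up>1 B\<up>1 (Var 0)) (Var 1))"

definition MorT :: "tm \<Rightarrow> tm \<Rightarrow> tm \<Rightarrow> tm \<Rightarrow> tm \<Rightarrow> tm \<Rightarrow> tm \<Rightarrow> tm" where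
  "MorT A B X g Y g' f = Pi A (Pi (Pi (App B\<up>1 (Var 0)) X\<up>2)
    (Eq Y\<up>2 (App f\<up>2 (App (App g\<up>2 (Var 1)) (Var 0)))
      (App (App g'\<up>2 (Var 1)) (Lam (App B\<up>2 (Var 1)) (App f\<up>3 (App (Var 1) (Var 0)))))))"

text \<open>Equal indices at different depths name different variables: the two occurrences of
  \<open>AlgT\<close> at \<open>Var 1\<close> are the algebras on X and on Y, and
  \<open>Pi (Var 3) (Var 3)\<close> is the type of maps from X to Y.\<close>

definition LimT :: "tm \<Rightarrow> tm \<Rightarrow> tm \<Rightarrow> tm" where
  "LimT A B w = Pi (Univ 0) (Pi (Univ 0) (Pi (AlgT A\<up>2 B\<up>2 (Var 1)) (Pi (AlgT A\<up>3 B\<up>3 (Var 1))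
    (Pi (Pi (Var 3) (Var 3)) (Pi (MorT A\<up>5 B\<up>5 (Var 4) (Var 2) (Var 3) (Var 1) (Var 0))
      (Eq (Var 4) (App (Var 1) (App (App w\<up>6 (Var 5)) (Var 3))) (App (App w\<up>6 (Var 4)) (Var 2))))))))"

definition WT :: "tm \<Rightarrow> tm \<Rightarrow> tm" where
  "WT A B = Sig (WstarT A B) (LimT A\<up>1 B\<up>1 (Var 0))"

definition supstarT :: "tm \<Rightarrow> tm \<Rightarrow> tm \<Rightarrow> tm \<Rightarrow> tm" where
  "supstarT A B a r = Lam (Univ 0) (Lam (AlgT A\<up>1 B\<up>1 (Var 0))
    (App (App (Var 0) a\<up>2) (Lam (App B\<up>2 a\<up>2) (App (App (App r\<up>3 (Var 0)) (Var 2)) (Var 1)))))"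

text \<open>The composite of the first projection with \<open>t\<close>, that is, the family passed
  to \<open>supstarT\<close> inside \<open>supT\<close>.\<close>

definition underT :: "tm \<Rightarrow> tm \<Rightarrow> tm \<Rightarrow> tm \<Rightarrow> tm" where
  "underT A B a t = Lam (App B a) (pr1 (WstarT A B)\<up>1 (App t\<up>1 (Var 0)))"

definition SupLimT :: "tm \<Rightarrow> tm \<Rightarrow> tm" where
  "SupLimT A B = Pi A (Pi (Pi (App B\<up>1 (Var 0)) (WT A B)\<up>2)
    (LimT A\<up>2 B\<up>2 (supstarT A\<up>2 B\<up>2 (Var 1) (underT A\<up>2 B\<up>2 (Var 1) (Var 0)))))"

definition supT :: "tm \<Rightarrow> tm \<Rightarrow> tm \<Rightarrow> tm" where
  "supT A B p = Lam A (Lam (Pi (App B\<up>1 (Var 0)) (WT A B)\<up>2)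
    (MkPair (supstarT A\<up>2 B\<up>2 (Var 1) (underT A\<up>2 B\<up>2 (Var 1) (Var 0)))
      (App (App p\<up>2 (Var 1)) (Var 0))))"

definition recT :: "tm \<Rightarrow> tm \<Rightarrow> tm \<Rightarrow> tm \<Rightarrow> tm" where
  "recT A B X g = Lam (WT A B) (App (App (pr1 (WstarT A B)\<up>1 (Var 0)) X\<up>1) g\<up>1)"

section \<open>Stability of the encoded constructions under substitution\<close>

lemma subst_AlgT: "subst \<sigma> (AlgT A B X) = AlgT (subst \<sigma> A) (subst \<sigma> B) (subst \<sigma> X)"
  by (simp add: AlgT_def sigma_simps)

lemma subst_WstarT: "subst \<sigma> (WstarT A B) = WstarT (subst \<sigma> A) (subst \<sigma> B)"
  by (simp add: WstarT_def subst_AlgT sigma_simps)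

lemma subst_MorT: "subst \<sigma> (MorT A B X g Y g' f) =
    MorT (subst \<sigma> A) (subst \<sigma> B) (subst \<sigma> X) (subst \<sigma> g) (subst \<sigma> Y) (subst \<sigma> g') (subst \<sigma> f)"
  by (simp add: MorT_def sigma_simps)

lemma subst_LimT: "subst \<sigma> (LimT A B w) = LimT (subst \<sigma> A) (subst \<sigma> B) (subst \<sigma> w)"
  by (simp add: LimT_def subst_AlgT subst_MorT sigma_simps)

lemma subst_WT: "subst \<sigma> (WT A B) = WT (subst \<sigma> A) (subst \<sigma> B)"
  by (simp add: WT_def subst_WstarT subst_LimT sigma_simps)

lemma subst_supstarT: "subst \<sigma> (supstarT A B a r) =
    supstarT (subst \<sigma> A) (subst \<sigma> B) (subst \<sigma> a) (subst \<sigma> r)"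
  by (simp add: supstarT_def subst_AlgT sigma_simps)

lemma subst_underT: "subst \<sigma> (underT A B a t) =
    underT (subst \<sigma> A) (subst \<sigma> B) (subst \<sigma> a) (subst \<sigma> t)"
  by (simp add: underT_def subst_WstarT subst_pr1 sigma_simps)

lemma subst_SupLimT: "subst \<sigma> (SupLimT A B) = SupLimT (subst \<sigma> A) (subst \<sigma> B)"
  by (simp add: SupLimT_def subst_WT subst_LimT subst_supstarT subst_underT sigma_simps)

lemma subst_supT: "subst \<sigma> (supT A B p) = supT (subst \<sigma> A) (subst \<sigma> B) (subst \<sigma> p)"
  by (simp add: supT_def subst_WT subst_supstarT subst_underT sigma_simps)

lemma subst_recT: "subst \<sigma> (recT A B X g) =
    recT (subst \<sigma> A) (subst \<sigma> B) (subst \<sigma> X) (subst \<sigma> g)"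
  by (simp add: recT_def subst_WT subst_WstarT subst_pr1 sigma_simps)

text \<open>With these rules substitutions reach the parameters while the constructions themselves
  stay folded.\<close>

lemmas subst_T = subst_AlgT subst_WstarT subst_MorT subst_LimT subst_WT subst_supstarT subst_underT
  subst_SupLimT subst_supT subst_recT subst_pr1 subst_pr2

section \<open>Formation and elimination of arrows, algebras, morphisms and the limit
  condition\<close>

lemma shift_type:
  assumes "\<Gamma> \<turnstile> a \<Colon> A" and "ctx \<Delta>" and "drop k \<Delta> = \<Gamma>"
  shows "\<Delta> \<turnstile> a\<up>k \<Colon> A\<up>k"
  using weaken[OF assms(2), of k] assms(1,3) by blast

lemma shift_arr: "\<Gamma> \<turnstile> f \<Colon> Pi X Y\<up>1 \<Longrightarrow> ctx \<Delta> \<Longrightarrow> drop k \<Delta> = \<Gamma> \<Longrightarrow> \<Delta> \<turnstile> f\<up>k \<Colon> Pi X\<up>k (Y\<up>k)\<up>1"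
  using shift_type[of \<Gamma> f "Pi X Y\<up>1" \<Delta> k] by (simp add: sigma_simps)

lemma arr_type: "\<Gamma> \<turnstile> X \<Colon> Univ i \<Longrightarrow> \<Gamma> \<turnstile> Y \<Colon> Univ 0 \<Longrightarrow> \<Gamma> \<turnstile> Pi X Y\<up>1 \<Colon> Univ 0"
  using shift_type[of \<Gamma> Y "Univ 0" "X # \<Gamma>" 1] by (intro Pi_type) (auto intro: ctx_Cons)

lemma arr_App: "\<Gamma> \<turnstile> f \<Colon> Pi X Y\<up>1 \<Longrightarrow> \<Gamma> \<turnstile> x \<Colon> X \<Longrightarrow> \<Gamma> \<turnstile> App f x \<Colon> Y"
  by (erule App_type) (simp_all add: sigma_simps)

lemma arr_comp:
  assumes D: "\<Gamma> \<turnstile> D \<Colon> Univ i" and f: "\<Gamma> \<turnstile> f \<Colon> Pi X Y\<up>1" and t: "\<Gamma> \<turnstile> t \<Colon> Pi D X\<up>1"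
  shows "\<Gamma> \<turnstile> Lam D (App f\<up>1 (App t\<up>1 (Var 0))) \<Colon> Pi D Y\<up>1"
proof (rule ty_Lam[OF D])
  note ctx = ctx_Cons[OF D]
  have "D # \<Gamma> \<turnstile> Var 0 \<Colon> D\<up>1"
    by (rule Var_type[OF ctx]) simp_all
  then show "D # \<Gamma> \<turnstile> App f\<up>1 (App t\<up>1 (Var 0)) \<Colon> Y\<up>1"
    using shift_arr[OF f ctx, of 1] shift_arr[OF t ctx, of 1] arr_App by simp
qed

definition signature :: "tm list \<Rightarrow> tm \<Rightarrow> tm \<Rightarrow> bool" where
  "signature \<Gamma> A B \<longleftrightarrow> \<Gamma> \<turnstile> A \<Colon> Univ 0 \<and> \<Gamma> \<turnstile> B \<Colon> Pi A (Univ 0)"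

lemma signature_shift:
  assumes "signature \<Gamma> A B" and "ctx \<Delta>" and "drop k \<Delta> = \<Gamma>"
  shows "signature \<Delta> A\<up>k B\<up>k"
  using assms shift_type[OF _ assms(2,3)] unfolding signature_def by fastforce

lemma signature_App: "signature \<Gamma> A B \<Longrightarrow> \<Gamma> \<turnstile> a \<Colon> A \<Longrightarrow> \<Gamma> \<turnstile> App B a \<Colon> Univ 0"
  unfolding signature_def by (auto intro: App_type simp: sigma_simps)

lemma family_arr_type:
  assumes S: "signature \<Gamma> A B" and X: "\<Gamma> \<turnstile> X \<Colon> Univ 0"
  shows "A # \<Gamma> \<turnstile> Pi (App B\<up>1 (Var 0)) X\<up>2 \<Colon> Univ 0"
proof -
  have ctx: "ctx (A # \<Gamma>)" using S ctx_Cons by (auto simp: signature_def)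
  have "A # \<Gamma> \<turnstile> App B\<up>1 (Var 0) \<Colon> Univ 0"
    by (rule signature_App[OF signature_shift[OF S ctx]], simp, rule Var_type[OF ctx]) simp_all
  from arr_type[OF this, of "X\<up>1"] shift_type[OF X ctx, of 1] show ?thesis
    by (simp add: sigma_simps)
qed

text \<open>The context of a generic constructor argument, a label and a family of elements of
  \<open>X\<close> over it; morphism equations and the body of \<open>SupLimT\<close> are typed
  there.\<close>

lemma family_ctx:
  assumes "signature \<Gamma> A B" and "\<Gamma> \<turnstile> X \<Colon> Univ 0"
  shows "ctx (Pi (App B\<up>1 (Var 0)) X\<up>2 # A # \<Gamma>)"
  using family_arr_type[OF assms] by (rule ctx_Cons)

lemma AlgT_type:
  assumes S: "signature \<Gamma> A B" and X: "\<Gamma> \<turnstile> X \<Colon> Univ 0"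
  shows "\<Gamma> \<turnstile> AlgT A B X \<Colon> Univ 0"
proof -
  have "ctx (A # \<Gamma>)" using S ctx_Cons by (auto simp: signature_def)
  from shift_type[OF X this, of 1] have "A # \<Gamma> \<turnstile> X\<up>1 \<Colon> Univ 0" by simp
  from arr_type[OF family_arr_type[OF S X] this] show ?thesis
    unfolding AlgT_def using S
    by (auto intro!: Pi_type simp: signature_def sigma_simps)
qed

lemma AlgT_App:
  assumes "\<Gamma> \<turnstile> g \<Colon> AlgT A B X" and "\<Gamma> \<turnstile> a \<Colon> A" and "\<Gamma> \<turnstile> t \<Colon> Pi (App B a) X\<up>1"
  shows "\<Gamma> \<turnstile> App (App g a) t \<Colon> X"
  by (rule arr_App[OF App_type[OF assms(1)[unfolded AlgT_def] assms(2)] assms(3)])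
    (simp add: sigma_simps)

lemma AlgT_App_cong:
  assumes "\<Gamma> \<turnstile> g \<Colon> AlgT A B X" and "\<Gamma> \<turnstile> a \<Colon> A" and "\<Gamma> \<turnstile> t \<doteq> t' \<Colon> Pi (App B a) X\<up>1"
  shows "\<Gamma> \<turnstile> App (App g a) t \<doteq> App (App g a) t' \<Colon> X"
  by (rule App_cong[OF eq_refl[OF App_type[OF assms(1)[unfolded AlgT_def] assms(2) refl],
        unfolded inst1_def subst.simps] _]) (use assms(3) in \<open>simp_all add: sigma_simps\<close>)

text \<open>The product over all of \<open>Univ 0\<close> stays in \<open>Univ 0\<close>:
  impredicativity enters here through \<open>Pi_type\<close>.\<close>

lemma WstarT_type:
  assumes S: "signature \<Gamma> A B"
  shows "\<Gamma> \<turnstile> WstarT A B \<Colon> Univ 0"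
proof -
  have ctx: "ctx (Univ 0 # \<Gamma>)"
    using S has_type_ctx(1) ty_Univ ctx_Cons unfolding signature_def by blast
  have X: "Univ 0 # \<Gamma> \<turnstile> Var 0 \<Colon> Univ 0"
    by (rule Var_type[OF ctx]) simp_all
  have "signature (Univ 0 # \<Gamma>) A\<up>1 B\<up>1"
    by (rule signature_shift[OF S ctx]) simp
  from arr_type[OF AlgT_type[OF this X] X] show ?thesis
    unfolding WstarT_def
    by (intro Pi_type[OF ty_Univ]) (use S has_type_ctx(1) in \<open>auto simp: sigma_simps signature_def\<close>)
qed

lemma WstarT_App:
  assumes "\<Gamma> \<turnstile> w \<Colon> WstarT A B" and "\<Gamma> \<turnstile> X \<Colon> Univ 0" and "\<Gamma> \<turnstile> g \<Colon> AlgT A B X"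
  shows "\<Gamma> \<turnstile> App (App w X) g \<Colon> X"
  by (rule arr_App[OF App_type[OF assms(1)[unfolded WstarT_def] assms(2)] assms(3)])
    (simp add: sigma_simps subst_T)

lemma MorT_type:
  assumes S: "signature \<Gamma> A B" and X: "\<Gamma> \<turnstile> X \<Colon> Univ 0" and Y: "\<Gamma> \<turnstile> Y \<Colon> Univ 0"
    and g: "\<Gamma> \<turnstile> g \<Colon> AlgT A B X" and g': "\<Gamma> \<turnstile> g' \<Colon> AlgT A B Y" and f: "\<Gamma> \<turnstile> f \<Colon> Pi X Y\<up>1"
  shows "\<Gamma> \<turnstile> MorT A B X g Y g' f \<Colon> Univ 0"
proof -
  note ctx = family_ctx[OF S X]
  let ?\<Delta> = "Pi (App B\<up>1 (Var 0)) X\<up>2 # A # \<Gamma>"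
  have S': "signature ?\<Delta> A\<up>2 B\<up>2" by (rule signature_shift[OF S ctx]) simp
  have a: "?\<Delta> \<turnstile> Var 1 \<Colon> A\<up>2" by (rule Var_type[OF ctx]) (simp_all add: sigma_simps)
  have t: "?\<Delta> \<turnstile> Var 0 \<Colon> Pi (App B\<up>2 (Var 1)) (X\<up>2)\<up>1"
    by (rule Var_type[OF ctx]) (simp_all add: sigma_simps)
  have g2: "?\<Delta> \<turnstile> g\<up>2 \<Colon> AlgT A\<up>2 B\<up>2 X\<up>2" "?\<Delta> \<turnstile> g'\<up>2 \<Colon> AlgT A\<up>2 B\<up>2 Y\<up>2"
    using shift_type[OF g ctx, of 2] shift_type[OF g' ctx, of 2] by (simp_all add: subst_T)
  have f2: "?\<Delta> \<turnstile> f\<up>2 \<Colon> Pi X\<up>2 (Y\<up>2)\<up>1"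
    using shift_arr[OF f ctx, of 2] by simp
  have Y2: "?\<Delta> \<turnstile> Y\<up>2 \<Colon> Univ 0"
    using shift_type[OF Y ctx, of 2] by simp
  \<comment> \<open>The composite keeps the iterated shifts of \<open>arr_comp\<close>; the
    substitution calculus later merges them into the form of \<open>MorT_def\<close>.\<close>
  have "?\<Delta> \<turnstile> Eq Y\<up>2 (App f\<up>2 (App (App g\<up>2 (Var 1)) (Var 0)))
      (App (App g'\<up>2 (Var 1)) (Lam (App B\<up>2 (Var 1)) (App (f\<up>2)\<up>1 (App (Var 0)\<up>1 (Var 0))))) \<Colon> Univ 0"
    by (intro ty_Eq[OF Y2] arr_App[OF f2] AlgT_App[OF g2(1) a t] AlgT_App[OF g2(2) a]
        arr_comp[OF signature_App[OF S' a] f2 t])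
  then show ?thesis
    unfolding MorT_def using S family_arr_type[OF S X]
    by (auto intro!: Pi_type simp: signature_def sigma_simps)
qed

text \<open>Being in \<open>Univ 0\<close> and being a proposition are both needed for
  \<open>LimT\<close>; bundled, they require only one passage through its telescope.\<close>

definition prop_type :: "tm list \<Rightarrow> tm \<Rightarrow> bool" where
  "prop_type \<Gamma> T \<longleftrightarrow> \<Gamma> \<turnstile> T \<Colon> Univ 0 \<and> is_prop \<Gamma> T"

lemma prop_type_Pi: "\<Gamma> \<turnstile> A \<Colon> Univ i \<Longrightarrow> prop_type (A # \<Gamma>) C \<Longrightarrow> prop_type \<Gamma> (Pi A C)"
  unfolding prop_type_def using Pi_type is_prop_Pi by blast

lemma prop_type_Eq: "\<Gamma> \<turnstile> A \<Colon> Univ 0 \<Longrightarrow> \<Gamma> \<turnstile> a \<Colon> A \<Longrightarrow> \<Gamma> \<turnstile> b \<Colon> A \<Longrightarrow> prop_type \<Gamma> (Eq A a b)"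
  unfolding prop_type_def using ty_Eq is_prop_Eq by blast

lemma prop_type_LimT:
  assumes S: "signature \<Gamma> A B" and w: "\<Gamma> \<turnstile> w \<Colon> WstarT A B"
  shows "prop_type \<Gamma> (LimT A B w)"
proof -
  \<comment> \<open>\<open>c1\<close> to \<open>c6\<close> follow the telescope of
    \<open>LimT\<close>: X, Y, their algebras g and g', the map f, and the proof that f is a
    morphism.\<close>
  note U = ty_Univ[OF has_type_ctx(1)[OF w]]
  note c1 = ctx_Cons[OF U]
  note U1 = ty_Univ[OF c1]
  note c2 = ctx_Cons[OF U1]
  have T2: "Univ 0 # Univ 0 # \<Gamma> \<turnstile> AlgT A\<up>2 B\<up>2 (Var 1) \<Colon> Univ 0" (is "?\<Gamma>2 \<turnstile> ?T2 \<Colon> _")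
    by (rule AlgT_type[OF signature_shift[OF S c2] Var_type[OF c2]]) simp_all
  note c3 = ctx_Cons[OF T2]
  have T3: "?T2 # ?\<Gamma>2 \<turnstile> AlgT A\<up>3 B\<up>3 (Var 1) \<Colon> Univ 0" (is "?\<Gamma>3 \<turnstile> ?T3 \<Colon> _")
    by (rule AlgT_type[OF signature_shift[OF S c3] Var_type[OF c3]]) simp_all
  note c4 = ctx_Cons[OF T3]
  have XY: "?T3 # ?\<Gamma>3 \<turnstile> Var 3 \<Colon> Univ 0" "?T3 # ?\<Gamma>3 \<turnstile> Var 2 \<Colon> Univ 0"
    by (rule Var_type[OF c4]; simp add: numeral_eq_Suc)+
  have T4: "?T3 # ?\<Gamma>3 \<turnstile> Pi (Var 3) (Var 3) \<Colon> Univ 0" (is "?\<Gamma>4 \<turnstile> ?T4 \<Colon> _")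
    using arr_type[OF XY] by (simp add: sigma_simps)
  note c5 = ctx_Cons[OF T4]
  have S5: "signature (?T4 # ?\<Gamma>4) A\<up>5 B\<up>5"
    by (rule signature_shift[OF S c5]) (simp add: numeral_eq_Suc)
  have T5: "?T4 # ?\<Gamma>4 \<turnstile> MorT A\<up>5 B\<up>5 (Var 4) (Var 2) (Var 3) (Var 1) (Var 0) \<Colon> Univ 0"
    (is "?\<Gamma>5 \<turnstile> ?T5 \<Colon> _")
    by (rule MorT_type[OF S5]; rule Var_type[OF c5]) (simp_all add: sigma_simps subst_T)
  note c6 = ctx_Cons[OF T5]
  let ?\<Gamma>6 = "?T5 # ?\<Gamma>5"
  have w6: "?\<Gamma>6 \<turnstile> w\<up>6 \<Colon> WstarT A\<up>6 B\<up>6"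
    using shift_type[OF w c6, of 6] by (simp add: numeral_eq_Suc subst_T)
  have V: "?\<Gamma>6 \<turnstile> Var 5 \<Colon> Univ 0" "?\<Gamma>6 \<turnstile> Var 4 \<Colon> Univ 0"
    "?\<Gamma>6 \<turnstile> Var 3 \<Colon> AlgT A\<up>6 B\<up>6 (Var 5)" "?\<Gamma>6 \<turnstile> Var 2 \<Colon> AlgT A\<up>6 B\<up>6 (Var 4)"
    "?\<Gamma>6 \<turnstile> Var 1 \<Colon> Pi (Var 5) (Var 4)\<up>1"
    by (rule Var_type[OF c6]; simp add: sigma_simps subst_T)+
  have "prop_type ?\<Gamma>6
      (Eq (Var 4) (App (Var 1) (App (App w\<up>6 (Var 5)) (Var 3))) (App (App w\<up>6 (Var 4)) (Var 2)))"
    by (intro prop_type_Eq V(2) arr_App[OF V(5)] WstarT_App[OF w6] V(1,3,4))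
  then show ?thesis
    unfolding LimT_def by (intro prop_type_Pi[OF U] prop_type_Pi[OF U1] prop_type_Pi[OF T2]
        prop_type_Pi[OF T3] prop_type_Pi[OF T4] prop_type_Pi[OF T5])
qed

text \<open>The intermediate types are spelled out so that each instantiation is normalised before
  the next argument is supplied.\<close>

lemma inh_LimT_App:
  assumes l: "inh \<Gamma> (LimT A B w)" and X: "\<Gamma> \<turnstile> X \<Colon> Univ 0" and Y: "\<Gamma> \<turnstile> Y \<Colon> Univ 0"
    and g: "\<Gamma> \<turnstile> g \<Colon> AlgT A B X" and g': "\<Gamma> \<turnstile> g' \<Colon> AlgT A B Y" and f: "\<Gamma> \<turnstile> f \<Colon> Pi X Y\<up>1"
    and m: "inh \<Gamma> (MorT A B X g Y g' f)"
  shows "inh \<Gamma> (Eq Y (App f (App (App w X) g)) (App (App w Y) g'))"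
proof -
  have "inh \<Gamma> (Pi (Univ 0) (Pi (AlgT A\<up>1 B\<up>1 X\<up>1) (Pi (AlgT A\<up>2 B\<up>2 (Var 1)) (Pi (Pi X\<up>3 (Var 3))
      (Pi (MorT A\<up>4 B\<up>4 X\<up>4 (Var 2) (Var 3) (Var 1) (Var 0))
      (Eq (Var 4) (App (Var 1) (App (App w\<up>5 X\<up>5) (Var 3))) (App (App w\<up>5 (Var 4)) (Var 2))))))))"
    by (rule inh_App[OF l[unfolded LimT_def] X]) (simp add: subst_T sigma_simps)
  then have "inh \<Gamma> (Pi (AlgT A B X) (Pi (AlgT A\<up>1 B\<up>1 Y\<up>1) (Pi (Pi X\<up>2 Y\<up>3)
      (Pi (MorT A\<up>3 B\<up>3 X\<up>3 (Var 2) Y\<up>3 (Var 1) (Var 0))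
      (Eq Y\<up>4 (App (Var 1) (App (App w\<up>4 X\<up>4) (Var 3))) (App (App w\<up>4 Y\<up>4) (Var 2)))))))"
    by (rule inh_App[OF _ Y]) (simp add: subst_T sigma_simps)
  then have "inh \<Gamma> (Pi (AlgT A B Y) (Pi (Pi X\<up>1 Y\<up>2)
      (Pi (MorT A\<up>2 B\<up>2 X\<up>2 g\<up>2 Y\<up>2 (Var 1) (Var 0))
      (Eq Y\<up>3 (App (Var 1) (App (App w\<up>3 X\<up>3) g\<up>3)) (App (App w\<up>3 Y\<up>3) (Var 2))))))"
    by (rule inh_App[OF _ g]) (simp add: subst_T sigma_simps)
  then have "inh \<Gamma> (Pi (Pi X Y\<up>1)
      (Pi (MorT A\<up>1 B\<up>1 X\<up>1 g\<up>1 Y\<up>1 g'\<up>1 (Var 0))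
      (Eq Y\<up>2 (App (Var 1) (App (App w\<up>2 X\<up>2) g\<up>2)) (App (App w\<up>2 Y\<up>2) g'\<up>2))))"
    by (rule inh_App[OF _ g']) (simp add: subst_T sigma_simps)
  then have "inh \<Gamma> (Pi (MorT A B X g Y g' f)
      (Eq Y\<up>1 (App f\<up>1 (App (App w\<up>1 X\<up>1) g\<up>1)) (App (App w\<up>1 Y\<up>1) g'\<up>1)))"
    by (rule inh_App[OF _ f]) (simp add: subst_T sigma_simps)
  moreover obtain m' where "\<Gamma> \<turnstile> m' \<Colon> MorT A B X g Y g' f"
    using m by (auto simp: inh_def)
  ultimately show ?thesis
    by (rule inh_App) (simp add: subst_T sigma_simps)
qed

lemma LimT_family_type:
  assumes S: "signature \<Gamma> A B"
  shows "WstarT A B # \<Gamma> \<turnstile> LimT A\<up>1 B\<up>1 (Var 0) \<Colon> Univ 0"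
proof -
  note ctx = ctx_Cons[OF WstarT_type[OF S]]
  have "prop_type (WstarT A B # \<Gamma>) (LimT A\<up>1 B\<up>1 (Var 0))"
    by (rule prop_type_LimT[OF signature_shift[OF S ctx] Var_type[OF ctx]]) (simp_all add: subst_T)
  then show ?thesis by (simp add: prop_type_def)
qed

text \<open>Both components of the sum lie in \<open>Univ 0\<close>, hence so does the sum. This
  makes \<open>WT A B\<close> a possible carrier when \<open>WstarT_App\<close> or
  \<open>inh_LimT_App\<close> is used.\<close>

lemma WT_type: "signature \<Gamma> A B \<Longrightarrow> \<Gamma> \<turnstile> WT A B \<Colon> Univ 0"
  using ty_Sig[OF WstarT_type LimT_family_type, of \<Gamma> A B] by (simp add: WT_def)

lemma WT_pr1:
  "signature \<Gamma> A B \<Longrightarrow> \<Gamma> \<turnstile> w \<Colon> WT A B \<Longrightarrow> \<Gamma> \<turnstile> pr1 (WstarT A B) w \<Colon> WstarT A B"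
  unfolding WT_def by (rule pr1_type[OF WstarT_type LimT_family_type])

lemma WT_pr2:
  "signature \<Gamma> A B \<Longrightarrow> \<Gamma> \<turnstile> w \<Colon> WT A B \<Longrightarrow> inh \<Gamma> (LimT A B (pr1 (WstarT A B) w))"
  unfolding WT_def
  by (drule pr2_type[OF WstarT_type LimT_family_type, rotated 2, THEN inhI])
    (simp_all add: subst_T sigma_simps)

lemma WT_pr1_cong:
  assumes S: "signature \<Gamma> A B" and eq: "\<Gamma> \<turnstile> v \<doteq> w \<Colon> WT A B"
    and v: "\<Gamma> \<turnstile> v \<Colon> WT A B" and w: "\<Gamma> \<turnstile> w \<Colon> WT A B"
  shows "\<Gamma> \<turnstile> pr1 (WstarT A B) v \<doteq> pr1 (WstarT A B) w \<Colon> WstarT A B"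
proof -
  note ctx = ctx_Cons[OF WT_type[OF S]]
  have "WT A B # \<Gamma> \<turnstile> pr1 (WstarT A\<up>1 B\<up>1) (Var 0) \<Colon> WstarT A\<up>1 B\<up>1"
    by (rule WT_pr1[OF signature_shift[OF S ctx] Var_type[OF ctx]]) (simp_all add: subst_T)
  then have "WT A B # \<Gamma> \<turnstile> pr1 (WstarT A B)\<up>1 (Var 0) \<Colon> (WstarT A B)\<up>(Suc 0)"
    by (simp add: subst_T)
  from inst1_cong[OF this eq v w] show ?thesis
    by (simp add: subst_T sigma_simps)
qed

lemma WstarT_App_cong:
  assumes "\<Gamma> \<turnstile> v \<doteq> w \<Colon> WstarT A B" and "\<Gamma> \<turnstile> X \<Colon> Univ 0" and "\<Gamma> \<turnstile> g \<Colon> AlgT A B X"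
  shows "\<Gamma> \<turnstile> App (App v X) g \<doteq> App (App w X) g \<Colon> X"
proof (rule App_cong[OF _ eq_refl[OF assms(3)]])
  show "\<Gamma> \<turnstile> App v X \<doteq> App w X \<Colon> Pi (AlgT A B X) X\<up>1"
    by (rule App_cong[OF assms(1)[unfolded WstarT_def] eq_refl[OF assms(2)]])
      (simp add: sigma_simps subst_T)
qed (simp add: sigma_simps)

section \<open>Typing and computation of \<open>supstarT\<close>, \<open>supT\<close> and
  \<open>recT\<close>\<close>

lemma underT_type:
  assumes S: "signature \<Gamma> A B" and a: "\<Gamma> \<turnstile> a \<Colon> A" and t: "\<Gamma> \<turnstile> t \<Colon> Pi (App B a) (WT A B)\<up>1"
  shows "\<Gamma> \<turnstile> underT A B a t \<Colon> Pi (App B a) (WstarT A B)\<up>1"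
  unfolding underT_def
proof (rule ty_Lam[OF signature_App[OF S a]])
  note ctx = ctx_Cons[OF signature_App[OF S a]]
  have "App B a # \<Gamma> \<turnstile> Var 0 \<Colon> (App B a)\<up>1"
    by (rule Var_type[OF ctx]) simp_all
  then have "App B a # \<Gamma> \<turnstile> App t\<up>1 (Var 0) \<Colon> (WT A B)\<up>1"
    by (rule arr_App[OF shift_arr[OF t ctx], rotated]) simp
  then show "App B a # \<Gamma> \<turnstile> pr1 (WstarT A B)\<up>1 (App t\<up>1 (Var 0)) \<Colon> (WstarT A B)\<up>1"
    using WT_pr1[OF signature_shift[OF S ctx], of 1] by (simp add: subst_T)
qed

lemma underT_beta:
  assumes S: "signature \<Gamma> A B" and a: "\<Gamma> \<turnstile> a \<Colon> A" and t: "\<Gamma> \<turnstile> t \<Colon> Pi (App B a) (WT A B)\<up>1"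
    and b: "\<Gamma> \<turnstile> b \<Colon> App B a"
  shows "\<Gamma> \<turnstile> App (underT A B a t) b \<doteq> pr1 (WstarT A B) (App t b) \<Colon> WstarT A B"
proof -
  note ctx = ctx_Cons[OF signature_App[OF S a]]
  have "App B a # \<Gamma> \<turnstile> Var 0 \<Colon> (App B a)\<up>1"
    by (rule Var_type[OF ctx]) simp_all
  then have "App B a # \<Gamma> \<turnstile> App t\<up>1 (Var 0) \<Colon> (WT A B)\<up>1"
    by (rule arr_App[OF shift_arr[OF t ctx], rotated]) simp
  then have "App B a # \<Gamma> \<turnstile> pr1 (WstarT A B)\<up>1 (App t\<up>1 (Var 0)) \<Colon> (WstarT A B)\<up>1"
    using WT_pr1[OF signature_shift[OF S ctx], of 1] by (simp add: subst_T)
  then show ?thesis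
    unfolding underT_def by (rule Pi_beta[OF _ b]) (simp_all add: subst_T sigma_simps)
qed

text \<open>Stated for arbitrary \<open>X\<close> and \<open>g\<close>; the bodies under the two
  binders of \<open>supstarT\<close> are typed by taking these to be variables.\<close>

lemma supstarT_body_type:
  assumes S: "signature \<Gamma> A B" and a: "\<Gamma> \<turnstile> a \<Colon> A" and r: "\<Gamma> \<turnstile> r \<Colon> Pi (App B a) (WstarT A B)\<up>1"
    and X: "\<Gamma> \<turnstile> X \<Colon> Univ 0" and g: "\<Gamma> \<turnstile> g \<Colon> AlgT A B X"
  shows "\<Gamma> \<turnstile> App (App g a) (Lam (App B a) (App (App (App r\<up>1 (Var 0)) X\<up>1) g\<up>1)) \<Colon> X"
proof (rule AlgT_App[OF g a ty_Lam[OF signature_App[OF S a]]])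
  note ctx = ctx_Cons[OF signature_App[OF S a]]
  have "App B a # \<Gamma> \<turnstile> Var 0 \<Colon> (App B a)\<up>1"
    by (rule Var_type[OF ctx]) simp_all
  then have "App B a # \<Gamma> \<turnstile> App r\<up>1 (Var 0) \<Colon> WstarT A\<up>1 B\<up>1"
    using arr_App[OF shift_arr[OF r ctx, of 1]] by (simp add: subst_T)
  then show "App B a # \<Gamma> \<turnstile> App (App (App r\<up>1 (Var 0)) X\<up>1) g\<up>1 \<Colon> X\<up>1"
    by (rule WstarT_App)
      (use shift_type[OF X ctx, of 1] shift_type[OF g ctx, of 1] in \<open>simp_all add: subst_T\<close>)
qed

lemma supstarT_inner_type:
  assumes S: "signature \<Gamma> A B" and a: "\<Gamma> \<turnstile> a \<Colon> A" and r: "\<Gamma> \<turnstile> r \<Colon> Pi (App B a) (WstarT A B)\<up>1"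
    and X: "\<Gamma> \<turnstile> X \<Colon> Univ 0"
  shows "AlgT A B X # \<Gamma> \<turnstile> App (App (Var 0) a\<up>1)
    (Lam (App B\<up>1 a\<up>1) (App (App (App r\<up>2 (Var 0)) X\<up>2) (Var 1))) \<Colon> X\<up>1"
proof -
  note ctx = ctx_Cons[OF AlgT_type[OF S X]]
  have "AlgT A B X # \<Gamma> \<turnstile> App (App (Var 0) a\<up>1)
    (Lam (App B\<up>1 a\<up>1) (App (App (App (r\<up>1)\<up>1 (Var 0)) (X\<up>1)\<up>1) (Var 0)\<up>1)) \<Colon> X\<up>1"
  proof (rule supstarT_body_type)
    show "AlgT A B X # \<Gamma> \<turnstile> Var 0 \<Colon> AlgT A\<up>1 B\<up>1 X\<up>1"
      by (rule Var_type[OF ctx]) (simp_all add: subst_T)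
  qed (use signature_shift[OF S ctx, of 1] shift_type[OF a ctx, of 1] shift_type[OF X ctx, of 1]
      shift_arr[OF r ctx, of 1] in \<open>simp_all add: subst_T\<close>)
  then show ?thesis by (simp add: sigma_simps)
qed

text \<open>The typing of the body is recorded as well, because \<open>Pi_beta\<close> takes it as a
  premise and no inversion of the typing of \<open>Lam\<close> is used.\<close>

lemma supstarT_type:
  assumes S: "signature \<Gamma> A B" and a: "\<Gamma> \<turnstile> a \<Colon> A" and r: "\<Gamma> \<turnstile> r \<Colon> Pi (App B a) (WstarT A B)\<up>1"
  shows "\<Gamma> \<turnstile> supstarT A B a r \<Colon> WstarT A B"
    and "Univ 0 # \<Gamma> \<turnstile> Lam (AlgT A\<up>1 B\<up>1 (Var 0)) (App (App (Var 0) a\<up>2)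
      (Lam (App B\<up>2 a\<up>2) (App (App (App r\<up>3 (Var 0)) (Var 2)) (Var 1)))) \<Colon> Pi (AlgT A\<up>1 B\<up>1 (Var 0)) (Var 1)"
proof -
  note U = ty_Univ[OF has_type_ctx(1)[OF a]]
  note ctx = ctx_Cons[OF U]
  note S' = signature_shift[OF S ctx, of 1, simplified]
  have X: "Univ 0 # \<Gamma> \<turnstile> Var 0 \<Colon> Univ 0"
    by (rule Var_type[OF ctx]) simp_all
  have "Univ 0 # \<Gamma> \<turnstile> r\<up>1 \<Colon> Pi (App B\<up>1 a\<up>1) (WstarT A\<up>1 B\<up>1)\<up>1"
    using shift_arr[OF r ctx, of 1] by (simp add: subst_T)
  moreover have "Univ 0 # \<Gamma> \<turnstile> a\<up>1 \<Colon> A\<up>1"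
    using shift_type[OF a ctx, of 1] by simp
  ultimately have "Univ 0 # \<Gamma> \<turnstile> Lam (AlgT A\<up>1 B\<up>1 (Var 0)) (App (App (Var 0) (a\<up>1)\<up>1)
      (Lam (App (B\<up>1)\<up>1 (a\<up>1)\<up>1) (App (App (App (r\<up>1)\<up>2 (Var 0)) (Var 0)\<up>2) (Var 1)))) \<Colon>
      Pi (AlgT A\<up>1 B\<up>1 (Var 0)) (Var 0)\<up>1"
    using S' X by (intro ty_Lam[OF AlgT_type] supstarT_inner_type) simp_all
  then show *: "Univ 0 # \<Gamma> \<turnstile> Lam (AlgT A\<up>1 B\<up>1 (Var 0)) (App (App (Var 0) a\<up>2)
      (Lam (App B\<up>2 a\<up>2) (App (App (App r\<up>3 (Var 0)) (Var 2)) (Var 1)))) \<Colon> Pi (AlgT A\<up>1 B\<up>1 (Var 0)) (Var 1)"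
    by (simp add: sigma_simps)
  show "\<Gamma> \<turnstile> supstarT A B a r \<Colon> WstarT A B"
    unfolding supstarT_def WstarT_def by (rule ty_Lam[OF U *])
qed

lemma supstarT_beta:
  assumes S: "signature \<Gamma> A B" and a: "\<Gamma> \<turnstile> a \<Colon> A" and r: "\<Gamma> \<turnstile> r \<Colon> Pi (App B a) (WstarT A B)\<up>1"
    and X: "\<Gamma> \<turnstile> X \<Colon> Univ 0" and g: "\<Gamma> \<turnstile> g \<Colon> AlgT A B X"
  shows "\<Gamma> \<turnstile> App (App (supstarT A B a r) X) g \<doteq>
    App (App g a) (Lam (App B a) (App (App (App r\<up>1 (Var 0)) X\<up>1) g\<up>1)) \<Colon> X"
proof -
  let ?h = "Lam (AlgT A B X) (App (App (Var 0) a\<up>1)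
    (Lam (App B\<up>1 a\<up>1) (App (App (App r\<up>2 (Var 0)) X\<up>2) (Var 1))))"
  have "\<Gamma> \<turnstile> App (supstarT A B a r) X \<doteq> ?h \<Colon> Pi (AlgT A B X) X\<up>1"
    unfolding supstarT_def
    by (rule Pi_beta[OF supstarT_type(2)[OF S a r] X]) (simp_all add: subst_T sigma_simps)
  then have "\<Gamma> \<turnstile> App (App (supstarT A B a r) X) g \<doteq> App ?h g \<Colon> X"
    by (rule App_cong[OF _ eq_refl[OF g]]) (simp add: sigma_simps)
  moreover have "\<Gamma> \<turnstile> App ?h g \<doteq>
      App (App g a) (Lam (App B a) (App (App (App r\<up>1 (Var 0)) X\<up>1) g\<up>1)) \<Colon> X"
    by (rule Pi_beta[OF supstarT_inner_type[OF S a r X] g]) (simp_all add: sigma_simps)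
  ultimately show ?thesis by (rule eq_trans)
qed

lemma SupLimT_type:
  assumes S: "signature \<Gamma> A B"
  shows "\<Gamma> \<turnstile> SupLimT A B \<Colon> Univ 0"
proof -
  note W = WT_type[OF S]
  note ctx = family_ctx[OF S W]
  let ?\<Delta> = "Pi (App B\<up>1 (Var 0)) (WT A B)\<up>2 # A # \<Gamma>"
  have S': "signature ?\<Delta> A\<up>2 B\<up>2" by (rule signature_shift[OF S ctx]) simp
  have a: "?\<Delta> \<turnstile> Var 1 \<Colon> A\<up>2" by (rule Var_type[OF ctx]) (simp_all add: sigma_simps)
  have t: "?\<Delta> \<turnstile> Var 0 \<Colon> Pi (App B\<up>2 (Var 1)) (WT A\<up>2 B\<up>2)\<up>1"
    by (rule Var_type[OF ctx]) (simp_all add: sigma_simps subst_T)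
  have "prop_type ?\<Delta> (LimT A\<up>2 B\<up>2 (supstarT A\<up>2 B\<up>2 (Var 1) (underT A\<up>2 B\<up>2 (Var 1) (Var 0))))"
    by (rule prop_type_LimT[OF S' supstarT_type(1)[OF S' a underT_type[OF S' a t]]])
  then show ?thesis
    unfolding SupLimT_def using S
    by (intro Pi_type[OF _ Pi_type[OF family_arr_type[OF S W]]])
      (auto simp: signature_def prop_type_def)
qed

text \<open>The value of \<open>supT\<close> at \<open>a\<close> and \<open>t\<close> once both beta
  steps have been carried out.\<close>

definition pairT :: "tm \<Rightarrow> tm \<Rightarrow> tm \<Rightarrow> tm \<Rightarrow> tm \<Rightarrow> tm" where
  "pairT A B p a t = MkPair (supstarT A B a (underT A B a t)) (App (App p a) t)"

lemma subst_pairT: "subst \<sigma> (pairT A B p a t) =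
    pairT (subst \<sigma> A) (subst \<sigma> B) (subst \<sigma> p) (subst \<sigma> a) (subst \<sigma> t)"
  by (simp add: pairT_def subst_T)

lemma SupLimT_App:
  assumes p: "\<Gamma> \<turnstile> p \<Colon> SupLimT A B" and a: "\<Gamma> \<turnstile> a \<Colon> A"
    and t: "\<Gamma> \<turnstile> t \<Colon> Pi (App B a) (WT A B)\<up>1"
  shows "\<Gamma> \<turnstile> App (App p a) t \<Colon> LimT A B (supstarT A B a (underT A B a t))"
proof (rule App_type[OF _ t])
  show "\<Gamma> \<turnstile> App p a \<Colon> Pi (Pi (App B a) (WT A B)\<up>1)
      (LimT A\<up>1 B\<up>1 (supstarT A\<up>1 B\<up>1 a\<up>1 (underT A\<up>1 B\<up>1 a\<up>1 (Var 0))))"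
    by (rule App_type[OF p[unfolded SupLimT_def] a]) (simp add: sigma_simps subst_T)
qed (simp add: sigma_simps subst_T)

context
  fixes \<Gamma> A B p
  assumes S: "signature \<Gamma> A B" and p: "\<Gamma> \<turnstile> p \<Colon> SupLimT A B"
begin

lemma pairT_type:
  assumes a: "\<Gamma> \<turnstile> a \<Colon> A" and t: "\<Gamma> \<turnstile> t \<Colon> Pi (App B a) (WT A B)\<up>1"
  shows "\<Gamma> \<turnstile> pairT A B p a t \<Colon> WT A B"
    and "\<Gamma> \<turnstile> pr1 (WstarT A B) (pairT A B p a t) \<doteq> supstarT A B a (underT A B a t) \<Colon> WstarT A B"
proof -
  note s = supstarT_type(1)[OF S a underT_type[OF S a t]]
  have l: "\<Gamma> \<turnstile> App (App p a) t \<Colon> inst1 (LimT A\<up>1 B\<up>1 (Var 0)) (supstarT A B a (underT A B a t))"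
    using SupLimT_App[OF p a t] by (simp add: sigma_simps subst_T)
  show "\<Gamma> \<turnstile> pairT A B p a t \<Colon> WT A B"
    unfolding pairT_def WT_def by (rule ty_MkPair[OF LimT_family_type[OF S] s l])
  show "\<Gamma> \<turnstile> pr1 (WstarT A B) (pairT A B p a t) \<doteq> supstarT A B a (underT A B a t) \<Colon> WstarT A B"
    unfolding pairT_def by (rule pr1_beta[OF WstarT_type[OF S] LimT_family_type[OF S] s l])
qed

end

lemma supT_inner_type:
  assumes S: "signature \<Gamma> A B" and p: "\<Gamma> \<turnstile> p \<Colon> SupLimT A B" and a: "\<Gamma> \<turnstile> a \<Colon> A"
  shows "Pi (App B a) (WT A B)\<up>1 # \<Gamma> \<turnstile> pairT A\<up>1 B\<up>1 p\<up>1 a\<up>1 (Var 0) \<Colon> (WT A B)\<up>1"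
proof -
  note ctx = ctx_Cons[OF arr_type[OF signature_App[OF S a] WT_type[OF S]]]
  have "Pi (App B a) (WT A B)\<up>1 # \<Gamma> \<turnstile> Var 0 \<Colon> Pi (App B\<up>1 a\<up>1) (WT A\<up>1 B\<up>1)\<up>1"
    by (rule Var_type[OF ctx]) (simp_all add: sigma_simps subst_T)
  with signature_shift[OF S ctx, of 1] shift_type[OF p ctx, of 1] shift_type[OF a ctx, of 1]
  show ?thesis
    using pairT_type(1) by (simp add: subst_T)
qed

lemma supT_body_type:
  assumes S: "signature \<Gamma> A B" and p: "\<Gamma> \<turnstile> p \<Colon> SupLimT A B"
  shows "A # \<Gamma> \<turnstile> Lam (Pi (App B\<up>1 (Var 0)) (WT A B)\<up>2) (pairT A\<up>2 B\<up>2 p\<up>2 (Var 1) (Var 0)) \<Colon>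
    Pi (Pi (App B\<up>1 (Var 0)) (WT A B)\<up>2) (WT A B)\<up>2"
proof (rule ty_Lam[OF family_arr_type[OF S WT_type[OF S]]])
  have ctx: "ctx (A # \<Gamma>)" using S ctx_Cons by (auto simp: signature_def)
  have "A # \<Gamma> \<turnstile> Var 0 \<Colon> A\<up>1"
    by (rule Var_type[OF ctx]) simp_all
  with signature_shift[OF S ctx, of 1] shift_type[OF p ctx, of 1]
  have "Pi (App B\<up>1 (Var 0)) (WT A\<up>1 B\<up>1)\<up>1 # A # \<Gamma> \<turnstile>
      pairT (A\<up>1)\<up>1 (B\<up>1)\<up>1 (p\<up>1)\<up>1 (Var 0)\<up>1 (Var 0) \<Colon> (WT A\<up>1 B\<up>1)\<up>1"
    by (intro supT_inner_type) (simp_all add: subst_T)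
  then show "Pi (App B\<up>1 (Var 0)) (WT A B)\<up>2 # A # \<Gamma> \<turnstile> pairT A\<up>2 B\<up>2 p\<up>2 (Var 1) (Var 0) \<Colon> (WT A B)\<up>2"
    by (simp add: sigma_simps subst_T)
qed

lemma supT_type:
  assumes S: "signature \<Gamma> A B" and p: "\<Gamma> \<turnstile> p \<Colon> SupLimT A B"
  shows "\<Gamma> \<turnstile> supT A B p \<Colon> AlgT A B (WT A B)"
  unfolding supT_def AlgT_def using S supT_body_type[OF S p, unfolded pairT_def]
  by (auto intro!: ty_Lam[of _ A] simp: signature_def)

lemma supT_beta:
  assumes S: "signature \<Gamma> A B" and p: "\<Gamma> \<turnstile> p \<Colon> SupLimT A B" and a: "\<Gamma> \<turnstile> a \<Colon> A"
    and t: "\<Gamma> \<turnstile> t \<Colon> Pi (App B a) (WT A B)\<up>1"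
  shows "\<Gamma> \<turnstile> App (App (supT A B p) a) t \<doteq> pairT A B p a t \<Colon> WT A B"
proof -
  let ?h = "Lam (Pi (App B a) (WT A B)\<up>1) (pairT A\<up>1 B\<up>1 p\<up>1 a\<up>1 (Var 0))"
  have "\<Gamma> \<turnstile> App (supT A B p) a \<doteq> ?h \<Colon> Pi (Pi (App B a) (WT A B)\<up>1) (WT A B)\<up>1"
    unfolding supT_def
    by (rule Pi_beta[OF supT_body_type[OF S p, unfolded pairT_def] a])
      (simp_all add: sigma_simps subst_T pairT_def)
  then have "\<Gamma> \<turnstile> App (App (supT A B p) a) t \<doteq> App ?h t \<Colon> WT A B"
    by (rule App_cong[OF _ eq_refl[OF t]]) (simp add: sigma_simps)
  moreover have "\<Gamma> \<turnstile> App ?h t \<doteq> pairT A B p a t \<Colon> WT A B"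
    by (rule Pi_beta[OF supT_inner_type[OF S p a] t]) (simp_all add: sigma_simps subst_T subst_pairT)
  ultimately show ?thesis by (rule eq_trans)
qed

lemma recT_body_type:
  assumes S: "signature \<Gamma> A B" and X: "\<Gamma> \<turnstile> X \<Colon> Univ 0" and g: "\<Gamma> \<turnstile> g \<Colon> AlgT A B X"
  shows "WT A B # \<Gamma> \<turnstile> App (App (pr1 (WstarT A B)\<up>1 (Var 0)) X\<up>1) g\<up>1 \<Colon> X\<up>1"
proof -
  note ctx = ctx_Cons[OF WT_type[OF S]]
  have "WT A B # \<Gamma> \<turnstile> pr1 (WstarT A\<up>1 B\<up>1) (Var 0) \<Colon> WstarT A\<up>1 B\<up>1"
    by (rule WT_pr1[OF signature_shift[OF S ctx] Var_type[OF ctx]]) (simp_all add: subst_T)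
  then show ?thesis
    using shift_type[OF X ctx, of 1] shift_type[OF g ctx, of 1]
    by (simp add: subst_T WstarT_App)
qed

lemma recT_type:
  assumes S: "signature \<Gamma> A B" and X: "\<Gamma> \<turnstile> X \<Colon> Univ 0" and g: "\<Gamma> \<turnstile> g \<Colon> AlgT A B X"
  shows "\<Gamma> \<turnstile> recT A B X g \<Colon> Pi (WT A B) X\<up>1"
  unfolding recT_def by (rule ty_Lam[OF WT_type[OF S] recT_body_type[OF assms]])

lemma recT_beta:
  assumes S: "signature \<Gamma> A B" and X: "\<Gamma> \<turnstile> X \<Colon> Univ 0" and g: "\<Gamma> \<turnstile> g \<Colon> AlgT A B X"
    and w: "\<Gamma> \<turnstile> w \<Colon> WT A B"
  shows "\<Gamma> \<turnstile> App (recT A B X g) w \<doteq> App (App (pr1 (WstarT A B) w) X) g \<Colon> X"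
  unfolding recT_def
  by (rule Pi_beta[OF recT_body_type[OF S X g] w]) (simp_all add: sigma_simps subst_T)

text \<open>The recursor computes judgementally: the projection of the constructed pair is
  \<open>supstarT\<close>, which applies \<open>g\<close> to the family of recursive values, and
  that family is \<open>recT\<close> composed with \<open>t\<close>.\<close>

lemma recT_supT:
  assumes S: "signature \<Gamma> A B" and p: "\<Gamma> \<turnstile> p \<Colon> SupLimT A B"
    and X: "\<Gamma> \<turnstile> X \<Colon> Univ 0" and g: "\<Gamma> \<turnstile> g \<Colon> AlgT A B X"
    and a: "\<Gamma> \<turnstile> a \<Colon> A" and t: "\<Gamma> \<turnstile> t \<Colon> Pi (App B a) (WT A B)\<up>1"
  shows "\<Gamma> \<turnstile> App (recT A B X g) (App (App (supT A B p) a) t) \<doteq>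
    App (App g a) (Lam (App B a) (App (recT A B X g)\<up>1 (App t\<up>1 (Var 0)))) \<Colon> X"
proof -
  let ?s = "App (App (supT A B p) a) t" and ?r = "underT A B a t" and ?D = "App B a"
  note r = underT_type[OF S a t]
  have s: "\<Gamma> \<turnstile> ?s \<Colon> WT A B"
    by (rule AlgT_App[OF supT_type[OF S p] a t])
  have "\<Gamma> \<turnstile> pr1 (WstarT A B) ?s \<doteq> supstarT A B a ?r \<Colon> WstarT A B"
    by (rule eq_trans[OF WT_pr1_cong[OF S supT_beta[OF S p a t] s] pairT_type(2)[OF S p a t]])
      (rule pairT_type(1)[OF S p a t])
  from WstarT_App_cong[OF this X g]
  have "\<Gamma> \<turnstile> App (recT A B X g) ?s \<doteq> App (App (supstarT A B a ?r) X) g \<Colon> X"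
    by (rule eq_trans[OF recT_beta[OF S X g s]])
  then have 1: "\<Gamma> \<turnstile> App (recT A B X g) ?s \<doteq>
      App (App g a) (Lam ?D (App (App (App ?r\<up>1 (Var 0)) X\<up>1) g\<up>1)) \<Colon> X"
    using supstarT_beta[OF S a r X g] by (rule eq_trans)
  note D = signature_App[OF S a]
  note ctx = ctx_Cons[OF D]
  have S': "signature (?D # \<Gamma>) A\<up>1 B\<up>1"
    by (rule signature_shift[OF S ctx]) simp
  have a': "?D # \<Gamma> \<turnstile> a\<up>1 \<Colon> A\<up>1" and X': "?D # \<Gamma> \<turnstile> X\<up>1 \<Colon> Univ 0"
    and g': "?D # \<Gamma> \<turnstile> g\<up>1 \<Colon> AlgT A\<up>1 B\<up>1 X\<up>1"
    and t': "?D # \<Gamma> \<turnstile> t\<up>1 \<Colon> Pi (App B\<up>1 a\<up>1) (WT A\<up>1 B\<up>1)\<up>1"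
    using shift_type[OF a ctx, of 1] shift_type[OF X ctx, of 1] shift_type[OF g ctx, of 1]
      shift_arr[OF t ctx, of 1] by (simp_all add: subst_T)
  have b: "?D # \<Gamma> \<turnstile> Var 0 \<Colon> App B\<up>1 a\<up>1"
    by (rule Var_type[OF ctx]) simp_all
  \<comment> \<open>Beta for \<open>underT\<close> exposes the projection of the subtree, and beta
    for \<open>recT\<close> read backwards folds this into a recursive call. Both happen under the
    abstraction, hence the weakened parameters.\<close>
  have "?D # \<Gamma> \<turnstile> App (App (App (underT A\<up>1 B\<up>1 a\<up>1 t\<up>1) (Var 0)) X\<up>1) g\<up>1 \<doteq>
      App (recT A\<up>1 B\<up>1 X\<up>1 g\<up>1) (App t\<up>1 (Var 0)) \<Colon> X\<up>1"
    by (rule eq_trans[OF WstarT_App_cong[OF underT_beta[OF S' a' t' b] X' g']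
          eq_sym[OF recT_beta[OF S' X' g' arr_App[OF t' b]]]])
  then have "\<Gamma> \<turnstile> Lam ?D (App (App (App ?r\<up>1 (Var 0)) X\<up>1) g\<up>1) \<doteq>
      Lam ?D (App (recT A B X g)\<up>1 (App t\<up>1 (Var 0))) \<Colon> Pi ?D X\<up>1"
    by (intro cong_Lam[OF D eq_refl[OF D]]) (simp add: subst_T)
  from eq_trans[OF 1 AlgT_App_cong[OF g a this]] show ?thesis .
qed

text \<open>By \<open>recT_supT\<close> the two sides of the morphism equation are convertible, so
  reflexivity proves it after a conversion of its type.\<close>

lemma inh_MorT_recT:
  assumes S: "signature \<Gamma> A B" and p: "\<Gamma> \<turnstile> p \<Colon> SupLimT A B"
    and X: "\<Gamma> \<turnstile> X \<Colon> Univ 0" and g: "\<Gamma> \<turnstile> g \<Colon> AlgT A B X"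
  shows "inh \<Gamma> (MorT A B (WT A B) (supT A B p) X g (recT A B X g))"
proof -
  note W = WT_type[OF S]
  note ctx = family_ctx[OF S W]
  let ?\<Delta> = "Pi (App B\<up>1 (Var 0)) (WT A B)\<up>2 # A # \<Gamma>"
  have S': "signature ?\<Delta> A\<up>2 B\<up>2" by (rule signature_shift[OF S ctx]) simp
  have a: "?\<Delta> \<turnstile> Var 1 \<Colon> A\<up>2" by (rule Var_type[OF ctx]) (simp_all add: sigma_simps)
  have t: "?\<Delta> \<turnstile> Var 0 \<Colon> Pi (App B\<up>2 (Var 1)) (WT A\<up>2 B\<up>2)\<up>1"
    by (rule Var_type[OF ctx]) (simp_all add: sigma_simps subst_T)
  have p': "?\<Delta> \<turnstile> p\<up>2 \<Colon> SupLimT A\<up>2 B\<up>2" and X': "?\<Delta> \<turnstile> X\<up>2 \<Colon> Univ 0"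
    and g': "?\<Delta> \<turnstile> g\<up>2 \<Colon> AlgT A\<up>2 B\<up>2 X\<up>2"
    using shift_type[OF p ctx, of 2] shift_type[OF X ctx, of 2] shift_type[OF g ctx, of 2]
    by (simp_all add: subst_T)
  let ?R = "recT A\<up>2 B\<up>2 X\<up>2 g\<up>2" and ?s = "App (App (supT A\<up>2 B\<up>2 p\<up>2) (Var 1)) (Var 0)"
  have l: "?\<Delta> \<turnstile> App ?R ?s \<Colon> X\<up>2"
    by (rule arr_App[OF recT_type[OF S' X' g'] AlgT_App[OF supT_type[OF S' p'] a t]])
  have "?\<Delta> \<turnstile> Eq X\<up>2 (App ?R ?s) (App ?R ?s) \<doteq>
    Eq X\<up>2 (App ?R ?s) (App (App g\<up>2 (Var 1))
      (Lam (App B\<up>2 (Var 1)) (App ?R\<up>1 (App (Var 0)\<up>1 (Var 0))))) \<Colon> Univ 0"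
    by (rule cong_Eq[OF eq_refl[OF X'] eq_refl[OF l] recT_supT[OF S' p' X' g' a t]])
  from inh_conv[OF inh_Refl[OF l] this] show ?thesis
    unfolding MorT_def using S family_arr_type[OF S W]
    by (auto intro!: inh_Pi simp: signature_def sigma_simps subst_T)
qed

section \<open>Initiality\<close>

context
  fixes \<Gamma> A B p w
  assumes S: "signature \<Gamma> A B" and p: "\<Gamma> \<turnstile> p \<Colon> SupLimT A B" and w: "\<Gamma> \<turnstile> w \<Colon> WT A B"
begin

text \<open>The carrier supplied to \<open>w\<close> is \<open>WT A B\<close> itself, which is
  admissible by \<open>WT_type\<close>.\<close>

lemma rebuild_type: "\<Gamma> \<turnstile> App (App (pr1 (WstarT A B) w) (WT A B)) (supT A B p) \<Colon> WT A B"
  by (rule WstarT_App[OF WT_pr1[OF S w] WT_type[OF S] supT_type[OF S p]])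

text \<open>The limit condition speaks of \<open>recT\<close> applied to the rebuilt element.
  \<open>recT_beta\<close> turns this into an application to \<open>X\<close> and \<open>g\<close>,
  the shape needed for pointwise comparison in \<open>WstarT\<close>.\<close>

lemma inh_rec_rebuild:
  assumes X: "\<Gamma> \<turnstile> X \<Colon> Univ 0" and g: "\<Gamma> \<turnstile> g \<Colon> AlgT A B X"
  shows "inh \<Gamma> (Eq X
    (App (App (pr1 (WstarT A B) (App (App (pr1 (WstarT A B) w) (WT A B)) (supT A B p))) X) g)
    (App (App (pr1 (WstarT A B) w) X) g))"
proof (rule inh_conv)
  show "inh \<Gamma> (Eq X (App (recT A B X g) (App (App (pr1 (WstarT A B) w) (WT A B)) (supT A B p)))
    (App (App (pr1 (WstarT A B) w) X) g))"
    by (rule inh_LimT_App[OF WT_pr2[OF S w] WT_type[OF S] X supT_type[OF S p] g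
          recT_type[OF S X g] inh_MorT_recT[OF S p X g]])
qed (rule cong_Eq[OF eq_refl[OF X] recT_beta[OF S X g rebuild_type]
      eq_refl[OF WstarT_App[OF WT_pr1[OF S w] X g]]])

end

lemma inh_rebuild:
  assumes S: "signature \<Gamma> A B" and p: "\<Gamma> \<turnstile> p \<Colon> SupLimT A B" and w: "\<Gamma> \<turnstile> w \<Colon> WT A B"
  shows "inh \<Gamma> (Eq (WT A B) (App (App (pr1 (WstarT A B) w) (WT A B)) (supT A B p)) w)"
proof -
  let ?v = "App (App (pr1 (WstarT A B) w) (WT A B)) (supT A B p)"
  note v = rebuild_type[OF S p w]
  note U = ty_Univ[OF has_type_ctx(1)[OF w]]
  note c1 = ctx_Cons[OF U]
  have T: "Univ 0 # \<Gamma> \<turnstile> AlgT A\<up>1 B\<up>1 (Var 0) \<Colon> Univ 0"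
    by (rule AlgT_type[OF signature_shift[OF S c1] Var_type[OF c1]]) simp_all
  note c2 = ctx_Cons[OF T]
  let ?\<Delta> = "AlgT A\<up>1 B\<up>1 (Var 0) # Univ 0 # \<Gamma>"
  have X: "?\<Delta> \<turnstile> Var 1 \<Colon> Univ 0" and g: "?\<Delta> \<turnstile> Var 0 \<Colon> AlgT A\<up>2 B\<up>2 (Var 1)"
    by (rule Var_type[OF c2]; simp add: subst_T sigma_simps)+
  have S2: "signature ?\<Delta> A\<up>2 B\<up>2"
    by (rule signature_shift[OF S c2]) simp
  have p2: "?\<Delta> \<turnstile> p\<up>2 \<Colon> SupLimT A\<up>2 B\<up>2" and w2: "?\<Delta> \<turnstile> w\<up>2 \<Colon> WT A\<up>2 B\<up>2"
    using shift_type[OF p c2, of 2] shift_type[OF w c2, of 2] by (simp_all add: subst_T)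
  \<comment> \<open>The pointwise identity at a generic carrier and a generic algebra, so
    \<open>w\<close> and \<open>p\<close> are moved into the context of these two variables.\<close>
  have pt: "inh ?\<Delta> (Eq (Var 1) (App (App (pr1 (WstarT A B) ?v)\<up>2 (Var 1)) (Var 0))
      (App (App (pr1 (WstarT A B) w)\<up>2 (Var 1)) (Var 0)))"
    using inh_rec_rebuild[OF S2 p2 w2 X g] by (simp add: subst_T)
  have app: "Univ 0 # \<Gamma> \<turnstile> App u\<up>1 (Var 0) \<Colon> Pi (AlgT A\<up>1 B\<up>1 (Var 0)) (Var 1)"
    if "\<Gamma> \<turnstile> u \<Colon> WstarT A B" for u
  proof (rule App_type)
    show "Univ 0 # \<Gamma> \<turnstile> u\<up>1 \<Colon> Pi (Univ 0) (Pi (AlgT A\<up>2 B\<up>2 (Var 0)) (Var 1))"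
      using shift_type[OF that c1, of 1] by (simp add: WstarT_def subst_T sigma_simps)
    show "Univ 0 # \<Gamma> \<turnstile> Var 0 \<Colon> Univ 0"
      by (rule Var_type[OF c1]) simp_all
  qed (simp add: subst_T sigma_simps)
  note pv = WT_pr1[OF S v] and pw = WT_pr1[OF S w]
  have "inh (Univ 0 # \<Gamma>) (Eq (Pi (AlgT A\<up>1 B\<up>1 (Var 0)) (Var 1))
      (App (pr1 (WstarT A B) ?v)\<up>1 (Var 0)) (App (pr1 (WstarT A B) w)\<up>1 (Var 0)))"
    by (rule inh_funext[OF T X app[OF pv] app[OF pw]]) (use pt in \<open>simp add: sigma_simps\<close>)
  \<comment> \<open>Function extensionality a second time, now over the carrier; its domain
    \<open>Univ 0\<close> lies in \<open>Univ 1\<close>, so the axiom is needed above the bottom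
    universe.\<close>
  then have "inh \<Gamma> (Eq (WstarT A B) (pr1 (WstarT A B) ?v) (pr1 (WstarT A B) w))"
    unfolding WstarT_def
    by (intro inh_funext[OF U Pi_type[OF T X]])
      (use pv pw in \<open>simp_all add: WstarT_def numeral_eq_Suc\<close>)
  moreover have "is_prop (LimT A B (pr1 (WstarT A B) ?v) # \<Gamma>) (LimT A B (pr1 (WstarT A B) ?v))\<up>1"
  proof -
    note c = ctx_Cons[OF prop_type_LimT[OF S pv, unfolded prop_type_def, THEN conjunct1]]
    have "prop_type (LimT A B (pr1 (WstarT A B) ?v) # \<Gamma>) (LimT A\<up>1 B\<up>1 (pr1 (WstarT A B) ?v)\<up>1)"
      using prop_type_LimT[OF signature_shift[OF S c, of 1]] shift_type[OF pv c, of 1]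
      by (simp add: subst_T)
    then show ?thesis by (simp add: prop_type_def subst_T)
  qed
  ultimately have "inh \<Gamma> (Eq (Sig (WstarT A B) (LimT A\<up>1 B\<up>1 (Var 0))) ?v w)"
    by (intro inh_Eq_Sig[OF WstarT_type[OF S] LimT_family_type[OF S]])
      (use v w in \<open>simp_all add: WT_def sigma_simps subst_T\<close>)
  then show ?thesis by (simp add: WT_def)
qed

lemma inh_Eq_rec:
  assumes S: "signature \<Gamma> A B" and p: "\<Gamma> \<turnstile> p \<Colon> SupLimT A B" and w: "\<Gamma> \<turnstile> w \<Colon> WT A B"
    and X: "\<Gamma> \<turnstile> X \<Colon> Univ 0" and g: "\<Gamma> \<turnstile> g \<Colon> AlgT A B X" and f: "\<Gamma> \<turnstile> f \<Colon> Pi (WT A B) X\<up>1"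
    and m: "inh \<Gamma> (MorT A B (WT A B) (supT A B p) X g f)"
  shows "inh \<Gamma> (Eq X (App f w) (App (recT A B X g) w))"
proof -
  let ?v = "App (App (pr1 (WstarT A B) w) (WT A B)) (supT A B p)"
  let ?r = "App (App (pr1 (WstarT A B) w) X) g"
  note W = WT_type[OF S] and v = rebuild_type[OF S p w]
  note r = WstarT_App[OF WT_pr1[OF S w] X g]
  have "inh \<Gamma> (Eq X (App f ?v) ?r)"
    by (rule inh_LimT_App[OF WT_pr2[OF S w] W X supT_type[OF S p] g f m])
  \<comment> \<open>Only the argument of \<open>f\<close> is abstracted. \<open>w\<close> also
    occurs in \<open>?r\<close>, which is shifted and hence constant, so transport replaces the
    rebuilt element by \<open>w\<close> in that one place.\<close>
  moreover have "WT A B # \<Gamma> \<turnstile> Eq X\<up>1 (App f\<up>1 (Var 0)) ?r\<up>1 \<Colon> Univ 0" (is "_ \<turnstile> ?C \<Colon> _")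
  proof (rule ty_Eq)
    note ctx = ctx_Cons[OF W]
    have "WT A B # \<Gamma> \<turnstile> Var 0 \<Colon> (WT A B)\<up>1"
      by (rule Var_type[OF ctx]) simp_all
    then show "WT A B # \<Gamma> \<turnstile> App f\<up>1 (Var 0) \<Colon> X\<up>1"
      by (rule arr_App[OF shift_arr[OF f ctx], rotated]) simp
    show "WT A B # \<Gamma> \<turnstile> X\<up>1 \<Colon> Univ 0"
      using shift_type[OF X ctx, of 1] by simp
    show "WT A B # \<Gamma> \<turnstile> ?r\<up>1 \<Colon> X\<up>1"
      by (rule shift_type[OF r ctx]) simp
  qed
  ultimately have "inh \<Gamma> (inst1 ?C w)"
    by (intro inh_transport[OF inh_rebuild[OF S p w] v w]) (simp_all add: sigma_simps)
  then have "inh \<Gamma> (Eq X (App f w) ?r)"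
    by (simp add: sigma_simps)
  then show ?thesis
    by (rule inh_conv) (rule cong_Eq[OF eq_refl[OF X] eq_refl[OF arr_App[OF f w]]
          eq_sym[OF recT_beta[OF S X g w]]])
qed

text \<open>\<open>inh_Eq_rec\<close> at a fresh variable of type \<open>WT A B\<close>, with all
  hypotheses weakened, is the pointwise premise of function extensionality.\<close>

lemma inh_rec_unique:
  assumes S: "signature \<Gamma> A B" and p: "\<Gamma> \<turnstile> p \<Colon> SupLimT A B"
    and X: "\<Gamma> \<turnstile> X \<Colon> Univ 0" and g: "\<Gamma> \<turnstile> g \<Colon> AlgT A B X" and f: "\<Gamma> \<turnstile> f \<Colon> Pi (WT A B) X\<up>1"
    and m: "inh \<Gamma> (MorT A B (WT A B) (supT A B p) X g f)"
  shows "inh \<Gamma> (Eq (Pi (WT A B) X\<up>1) f (recT A B X g))"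
proof -
  note W = WT_type[OF S]
  note ctx = ctx_Cons[OF W]
  have X': "WT A B # \<Gamma> \<turnstile> X\<up>1 \<Colon> Univ 0"
    using shift_type[OF X ctx, of 1] by simp
  have "inh (WT A B # \<Gamma>) (Eq X\<up>1 (App f\<up>1 (Var 0)) (App (recT A\<up>1 B\<up>1 X\<up>1 g\<up>1) (Var 0)))"
  proof (rule inh_Eq_rec)
    show "WT A B # \<Gamma> \<turnstile> Var 0 \<Colon> WT A\<up>1 B\<up>1"
      by (rule Var_type[OF ctx]) (simp_all add: subst_T)
    show "inh (WT A B # \<Gamma>) (MorT A\<up>1 B\<up>1 (WT A\<up>1 B\<up>1) (supT A\<up>1 B\<up>1 p\<up>1) X\<up>1 g\<up>1 f\<up>1)"
      using inh_weaken[OF ctx, of 1] m by (force simp: subst_T)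
  qed (use X' signature_shift[OF S ctx, of 1] shift_type[OF p ctx, of 1] shift_type[OF g ctx, of 1]
      shift_arr[OF f ctx, of 1] in \<open>simp_all add: subst_T\<close>)
  then show ?thesis
    by (intro inh_funext[OF W X' f recT_type[OF S X g]]) (simp add: subst_T)
qed

text \<open>Unfolding at depth 0 turns every de Bruijn level into an index, which links the
  higher-order notation of the statement to the open-term constructions.\<close>

lemma otm_statement_eq:
  "PI (UU 0) (\<lambda>A. PI (A \<rightarrow> UU 0) (\<lambda>B. PI (SupLim A B) (\<lambda>p.
       PI (UU 0) (\<lambda>X. PI (AlgW A B X) (\<lambda>g. PI (W A B \<rightarrow> X) (\<lambda>f.
         MorphW A B (W A B) (supW A B p) X g f \<rightarrow> EQ (W A B \<rightarrow> X) f (recW A B X g))))))) 0 =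
   Pi (Univ 0) (Pi (Pi (Var 0) (Univ 0)) (Pi (SupLimT (Var 1) (Var 0)) (Pi (Univ 0)
    (Pi (AlgT (Var 3) (Var 2) (Var 0)) (Pi (Pi (WT (Var 4) (Var 3)) (Var 2))
    (Pi (MorT (Var 5) (Var 4) (WT (Var 5) (Var 4)) (supT (Var 5) (Var 4) (Var 3)) (Var 2) (Var 1) (Var 0))
      (Eq (Pi (WT (Var 6) (Var 5)) (Var 4)) (Var 1) (recT (Var 6) (Var 5) (Var 3) (Var 2)))))))))"
  by (simp add: otm_defs SupLim_def AlgW_def W_def MorphW_def supW_def recW_def Wstar_def LimW_def
      supstar_def recstar_def SupLimT_def AlgT_def WT_def MorT_def supT_def recT_def WstarT_def LimT_def
      supstarT_def underT_def pr1_def sigma_simps)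

theorem theorem8p4p8:
  shows "inhabited
    (PI (UU 0) (\<lambda>A. PI (A \<rightarrow> UU 0) (\<lambda>B. PI (SupLim A B) (\<lambda>p.
       PI (UU 0) (\<lambda>X. PI (AlgW A B X) (\<lambda>g. PI (W A B \<rightarrow> X) (\<lambda>f.
         MorphW A B (W A B) (supW A B p) X g f \<rightarrow> EQ (W A B \<rightarrow> X) f (recW A B X g))))))) 0)"
proof -
  \<comment> \<open>\<open>c1\<close> to \<open>c7\<close> add the hypotheses one by one: A, B, the
    proof \<open>p\<close>, X, g, f and the proof that f is a morphism. The uniqueness result is
    then applied to variables only.\<close>
  note T1 = ty_Univ[OF ctx_Nil, of 0]
  note c1 = ctx_Cons[OF T1]
  have A: "[Univ 0] \<turnstile> Var 0 \<Colon> Univ 0" by (rule Var_type[OF c1]) simp_all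
  \<comment> \<open>The type of families has level \<open>pi_level 0 1 = 1\<close>, above the bottom
    universe; \<open>inh_Pi\<close> accepts a domain of any level.\<close>
  have T2: "[Univ 0] \<turnstile> Pi (Var 0) (Univ 0) \<Colon> Univ (pi_level 0 1)"
    using ty_Pi[OF A ty_Univ[OF ctx_Cons[OF A]]] by simp
  note c2 = ctx_Cons[OF T2]
  have S2: "signature [Pi (Var 0) (Univ 0), Univ 0] (Var 1) (Var 0)" (is "signature ?\<Gamma>2 _ _")
    unfolding signature_def by (intro conjI; rule Var_type[OF c2]) (simp_all add: sigma_simps)
  note T3 = SupLimT_type[OF S2]
  note c3 = ctx_Cons[OF T3]
  let ?\<Gamma>3 = "SupLimT (Var 1) (Var 0) # ?\<Gamma>2"
  note T4 = ty_Univ[OF c3, of 0]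
  note c4 = ctx_Cons[OF T4]
  have S4: "signature (Univ 0 # ?\<Gamma>3) (Var 3) (Var 2)"
    using signature_shift[OF S2 c4, of 2] by (simp add: sigma_simps)
  have T5: "Univ 0 # ?\<Gamma>3 \<turnstile> AlgT (Var 3) (Var 2) (Var 0) \<Colon> Univ 0" (is "?\<Gamma>4 \<turnstile> ?T5 \<Colon> _")
    by (rule AlgT_type[OF S4 Var_type[OF c4]]) simp_all
  note c5 = ctx_Cons[OF T5]
  let ?\<Gamma>5 = "?T5 # ?\<Gamma>4"
  have S5: "signature ?\<Gamma>5 (Var 4) (Var 3)"
    using signature_shift[OF S4 c5, of 1] by (simp add: sigma_simps)
  have X5: "?\<Gamma>5 \<turnstile> Var 1 \<Colon> Univ 0" by (rule Var_type[OF c5]) simp_all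
  have T6: "?\<Gamma>5 \<turnstile> Pi (WT (Var 4) (Var 3)) (Var 2) \<Colon> Univ 0" (is "_ \<turnstile> ?T6 \<Colon> _")
    using arr_type[OF WT_type[OF S5] X5] by (simp add: sigma_simps)
  note c6 = ctx_Cons[OF T6]
  let ?\<Gamma>6 = "?T6 # ?\<Gamma>5"
  have S6: "signature ?\<Gamma>6 (Var 5) (Var 4)"
    using signature_shift[OF S5 c6, of 1] by (simp add: sigma_simps)
  have V6: "?\<Gamma>6 \<turnstile> Var 3 \<Colon> SupLimT (Var 5) (Var 4)" "?\<Gamma>6 \<turnstile> Var 2 \<Colon> Univ 0"
    "?\<Gamma>6 \<turnstile> Var 1 \<Colon> AlgT (Var 5) (Var 4) (Var 2)" "?\<Gamma>6 \<turnstile> Var 0 \<Colon> Pi (WT (Var 5) (Var 4)) (Var 2)\<up>1"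
    by (rule Var_type[OF c6]; simp add: sigma_simps subst_T)+
  have T7: "?\<Gamma>6 \<turnstile> MorT (Var 5) (Var 4) (WT (Var 5) (Var 4)) (supT (Var 5) (Var 4) (Var 3))
      (Var 2) (Var 1) (Var 0) \<Colon> Univ 0" (is "_ \<turnstile> ?T7 \<Colon> _")
    by (rule MorT_type[OF S6 WT_type[OF S6] V6(2) supT_type[OF S6 V6(1)] V6(3,4)])
  note c7 = ctx_Cons[OF T7]
  let ?\<Gamma>7 = "?T7 # ?\<Gamma>6"
  have S7: "signature ?\<Gamma>7 (Var 6) (Var 5)"
    using signature_shift[OF S6 c7, of 1] by (simp add: sigma_simps)
  have V7: "?\<Gamma>7 \<turnstile> Var 4 \<Colon> SupLimT (Var 6) (Var 5)" "?\<Gamma>7 \<turnstile> Var 3 \<Colon> Univ 0"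
    "?\<Gamma>7 \<turnstile> Var 2 \<Colon> AlgT (Var 6) (Var 5) (Var 3)" "?\<Gamma>7 \<turnstile> Var 1 \<Colon> Pi (WT (Var 6) (Var 5)) (Var 3)\<up>1"
    "?\<Gamma>7 \<turnstile> Var 0 \<Colon> MorT (Var 6) (Var 5) (WT (Var 6) (Var 5)) (supT (Var 6) (Var 5) (Var 4))
      (Var 3) (Var 2) (Var 1)"
    by (rule Var_type[OF c7]; simp add: sigma_simps subst_T)+
  from inh_rec_unique[OF S7 V7(1-4) inhI[OF V7(5)]]
  have "inh ?\<Gamma>7 (Eq (Pi (WT (Var 6) (Var 5)) (Var 4)) (Var 1) (recT (Var 6) (Var 5) (Var 3) (Var 2)))"
    by (simp add: sigma_simps)
  then have "inh [] (Pi (Univ 0) (Pi (Pi (Var 0) (Univ 0)) (Pi (SupLimT (Var 1) (Var 0)) (Pi (Univ 0)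
    (Pi ?T5 (Pi ?T6 (Pi ?T7
      (Eq (Pi (WT (Var 6) (Var 5)) (Var 4)) (Var 1) (recT (Var 6) (Var 5) (Var 3) (Var 2))))))))))"
    by (intro inh_Pi[OF T1] inh_Pi[OF T2] inh_Pi[OF T3] inh_Pi[OF T4] inh_Pi[OF T5] inh_Pi[OF T6]
        inh_Pi[OF T7])
  then show ?thesis
    unfolding otm_statement_eq by (simp add: inh_def inhabited_def)
qed

end
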